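(* If the equivalent contraction kernel (ECK) of the vertex representing the object in the adjacency graph of the homology-generator level, and the edges that survive to be in the boundary of the corresponding face in the boundary graph, are scanning and rotation invariant, then the cocycles obtained by down projection are scanning and rotation invariant. That is: let $\rho$ be a rotation of the plane by a multiple of $90$ degrees mapping the pixel grid to itself (the identity is allowed, corresponding to a different scanning of the same image). Let $I$ be a binary image and $I'=\rho(I)$, and let $P$, $P'$ be dual irregular graph pyramids built on $I$ and $I'$, with homology-generator levels $K^H$ and $K'^H$. Suppose that (a) the ECK of the vertex representing the object in $P'$ is the image under $\rho$ of the ECK of the vertex representing the object in $P$, and (b) the set of base-level edges surviving to be in the boundary of the object's face of $K'^H$ is the image under $\rho$ of the set of base-level edges surviving to be in the boundary of the object's face of $K^H$. Then, for every hole $O_i$ of the object in $I$, the down-projected cocycle computed from $P'$ for the hole $\rho(O_i)$ is the image under $\rho$ of the down-projected cocycle computed from $P$ for the hole $O_i$.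
   Context: All chains and cochains have $\mathbb{Z}/2$ coefficients. A $1$-cochain is identified with the set of edges on which it takes the value $1$. Image and pyramid. $I$ is a 2D binary digital image with pixels labelled "object" (foreground) or "background"; an object is a 4-connected set of foreground pixels. The adjacency graph $G_0$ has one vertex per pixel and an edge for each pair of 4-adjacent pixels; the boundary graph $\bar G_0$ is its dual, so faces of $\bar G_0$ correspond to vertices of $G_0$ (pixels) and edges of $\bar G_0$ correspond one-to-one to edges of $G_0$. A dual irregular graph pyramid is a finite sequence of pairs of dual plane multigraphs $(G_k,\bar G_k)$, $0\le k\le n$, where $(G_{k+1},\bar G_{k+1})$ is obtained from $(G_k,\bar G_k)$ as follows: (i) choose a nonempty set $T_k$ of edges of $G_k$, forming trees, each edge joining two vertices with the same label, and contract them (equivalently, remove the dual edges from $\bar G_k$; these are the removal edges of $\bar G_k$); (ii) contract all pendant trees of the resulting boundary graph (removing the dual edges); (iii) contract one distinct edge incident to each vertex of degree 2 of the resulting boundary graph (again removing the dual edges). The process stops at $n$ when no further edge can be chosen in (i). The trees formed by $T_k$ (and isolated vertices) are the contraction kernels of $G_k$; in each of them one vertex is chosen as surviving vertex (root). Edges of every level are identified with the base-level edges from which they survive. The receptive field of a vertex of $G_k$ is the set of pixels merged into it. Equivalent contraction kernel (ECK) of the vertex representing the object: the tree in $G_0$ whose vertices are the pixels of its receptive field (the object pixels) and whose edges are the base-level edges between these pixels that are contracted in some $G_k$ in step (i). Complexes. $K^k$, the boundary cell complex of level $k$, consists of all faces of $\bar G_k$ whose corresponding vertex of $G_k$ has a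 receptive field of foreground pixels only, together with all edges and vertices needed to represent these faces. The homology-generator level $K^H$ is obtained from $K^n$ by contracting all edges of a spanning tree of $\bar G_n$. It is taken to be connected; it has one vertex, one face $f$ (the object), and as edges self-loops $\alpha_1,\dots,\alpha_m$, each surrounding one background region $O_i$ (a hole of the object), and one self-loop $\beta$ surrounding $f$. Down-projected cocycle for the hole $O_i$: put $A_n=\{\alpha_i,\beta\}$ (as surviving edges in $\bar G_n$). For $k=n,\dots,1$ set $A_{k-1}=A^s_{k-1}\cup A^r_{k-1}$, where $A^s_{k-1}$ is the set of edges of $\bar G_{k-1}$ that survive to the edges in $A_k$, and $A^r_{k-1}$ is obtained as follows. In each contraction kernel $T$ of $G_{k-1}$ with object label, orient the edges toward the root, so that every non-root vertex $v$ is the starting vertex of a unique edge of $T$. From the leaves to the root, label each non-root $v$ by the number of edges of $A^s_{k-1}$ that lie in the boundary of the face of $\bar G_{k-1}$ associated to $v$, plus the labels of the children of $v$. A removal edge of $\bar G_{k-1}$ is in $A^r_{k-1}$ iff the starting vertex of its dual edge in the kernel has an odd label. The down-projected cocycle is $A_0$, a set of edges of $\bar G_0$. *)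

theory Defs
  imports Complex_Main
begin

section \<open>Binary images on the pixel grid\<close>

text \<open>A pixel is identified with its centre, a point of the integer lattice of the plane.\<close>

type_synonym pixel = "int \<times> int"

record image =
  pixels :: "pixel set"
  fg :: "pixel set"

definition bg :: "image \<Rightarrow> pixel set" where
  "bg I = pixels I - fg I"

definition binary_image :: "image \<Rightarrow> bool" where
  "binary_image I \<longleftrightarrow>
     (\<exists>a b c d. a \<le> b \<and> c \<le> d \<and> pixels I = {a..b} \<times> {c..d}) \<and> fg I \<subseteq> pixels I"

definition adj4 :: "pixel \<Rightarrow> pixel \<Rightarrow> bool" where
  "adj4 p q \<longleftrightarrow> \<bar>fst p - fst q\<bar> + \<bar>snd p - snd q\<bar> = 1"

definition connected4 :: "pixel set \<Rightarrow> bool" where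
  "connected4 X \<longleftrightarrow> X \<noteq> {} \<and>
     (\<forall>p\<in>X. \<forall>q\<in>X. (p, q) \<in> {(a, b). a \<in> X \<and> b \<in> X \<and> adj4 a b}\<^sup>*)"

text \<open>Kernels are made of edges of the 4-adjacency graph, so the background regions that
  become vertices of the top level are the 4-connected components of the background.\<close>

definition bg_regions :: "image \<Rightarrow> pixel set set" where
  "bg_regions I = {R. R \<subseteq> bg I \<and> connected4 R \<and>
     (\<forall>X. R \<subset> X \<and> X \<subseteq> bg I \<longrightarrow> \<not> connected4 X)}"

definition border :: "image \<Rightarrow> pixel set" where
  "border I = {p \<in> pixels I. \<exists>q. adj4 p q \<and> q \<notin> pixels I}"

definition holes :: "image \<Rightarrow> pixel set set" where
  "holes I = {R \<in> bg_regions I. R \<inter> border I = {}}"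

definition outer_regions :: "image \<Rightarrow> pixel set set" where
  "outer_regions I = {R \<in> bg_regions I. R \<inter> border I \<noteq> {}}"

text \<open>The foreground is one object. The self-loop surrounding it in the homology-generator
  level is the one that separates it from the region outside, so there has to be exactly one
  such region (as is the case whenever the object does not meet the border of the image).\<close>

definition object_image :: "image \<Rightarrow> bool" where
  "object_image I \<longleftrightarrow> binary_image I \<and> connected4 (fg I) \<and> (\<exists>!U. U \<in> outer_regions I)"

definition centre :: "pixel \<Rightarrow> complex" where
  "centre p = Complex (of_int (fst p)) (of_int (snd p))"

text \<open>The restriction to the pixels of a rotation of the plane by \<open>k\<close> quarter turns about \<open>c\<close>;
  since \<open>\<rho>\<close> takes values in pixels, the rotation maps the pixel grid to itself.\<close>

definition grid_rotation :: "(pixel \<Rightarrow> pixel) \<Rightarrow> bool" where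
  "grid_rotation \<rho> \<longleftrightarrow>
     (\<exists>(c::complex) (k::nat). \<forall>p. centre (\<rho> p) = c + \<i> ^ k * (centre p - c))"

definition rotate_image :: "(pixel \<Rightarrow> pixel) \<Rightarrow> image \<Rightarrow> image" where
  "rotate_image \<rho> I = \<lparr>pixels = \<rho> ` pixels I, fg = \<rho> ` fg I\<rparr>"


section \<open>Multigraphs with merged vertices\<close>

text \<open>A vertex is the set of base-level vertices merged into it. Edges keep their base-level
  names; an edge is a self-loop iff its set of ends is a singleton.\<close>

record ('a, 'e) multigraph =
  verts :: "'a set set"
  edges :: "'e set"
  ends :: "'e \<Rightarrow> 'a set set"

definition link :: "('a, 'e) multigraph \<Rightarrow> 'e set \<Rightarrow> ('a set \<times> 'a set) set" where
  "link G S = {(u, v). \<exists>e\<in>S. ends G e = {u, v}}"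

definition forest :: "('a, 'e) multigraph \<Rightarrow> 'e set \<Rightarrow> bool" where
  "forest G S \<longleftrightarrow> S \<subseteq> edges G \<and>
     (\<forall>e\<in>S. \<forall>u v. ends G e = {u, v} \<longrightarrow> (u, v) \<notin> (link G (S - {e}))\<^sup>*)"

definition spanning_tree :: "('a, 'e) multigraph \<Rightarrow> 'e set \<Rightarrow> bool" where
  "spanning_tree G S \<longleftrightarrow> forest G S \<and> (\<forall>u\<in>verts G. \<forall>v\<in>verts G. (u, v) \<in> (link G S)\<^sup>*)"

definition remove :: "'e set \<Rightarrow> ('a, 'e) multigraph \<Rightarrow> ('a, 'e) multigraph" where
  "remove S G = G\<lparr>edges := edges G - S\<rparr>"

definition merged :: "('a, 'e) multigraph \<Rightarrow> 'e set \<Rightarrow> 'a set \<Rightarrow> 'a set" where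
  "merged G S v = \<Union> {w \<in> verts G. (v, w) \<in> (link G S)\<^sup>*}"

definition contract :: "'e set \<Rightarrow> ('a, 'e) multigraph \<Rightarrow> ('a, 'e) multigraph" where
  "contract S G = \<lparr>verts = merged G S ` verts G,
                   edges = edges G - S,
                   ends = (\<lambda>e. merged G S ` ends G e)\<rparr>"

definition degree :: "('a, 'e) multigraph \<Rightarrow> 'a set \<Rightarrow> nat" where
  "degree G v = card {e \<in> edges G. v \<in> ends G e} + card {e \<in> edges G. ends G e = {v}}"

text \<open>Edges of the pendant trees, obtained by stripping leaves repeatedly.\<close>

inductive_set pendant :: "('a, 'e) multigraph \<Rightarrow> 'e set" for G :: "('a, 'e) multigraph" where
  leaf: "e \<in> pendant G"
  if "e \<in> edges G" "v \<in> ends G e" "ends G e \<noteq> {v}"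
     "\<And>e'. e' \<in> edges G \<Longrightarrow> v \<in> ends G e' \<Longrightarrow> e' \<noteq> e \<Longrightarrow> e' \<in> pendant G"


section \<open>Dual irregular graph pyramids\<close>

text \<open>A boundary edge is identified with the base-level adjacency edge it crosses, and that
  edge with the set of its two pixels.\<close>

type_synonym edge = "pixel set"

definition adjacency_graph :: "pixel set \<Rightarrow> (pixel, edge) multigraph" where
  "adjacency_graph D = \<lparr>verts = (\<lambda>p. {p}) ` D,
                        edges = {{p, q} | p q. p \<in> D \<and> q \<in> D \<and> adj4 p q},
                        ends = (\<lambda>e. (\<lambda>p. {p}) ` e)\<rparr>"

text \<open>The plane dual. The bounded faces of the adjacency graph are the 2 by 2 blocks of pixels,
  named by their lower left pixels; \<open>None\<close> is the unbounded face. Every edge lies in exactly two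
  blocks of the plane; a block that is not contained in the image is part of the unbounded
  face.\<close>

definition block :: "pixel \<Rightarrow> pixel set" where
  "block b = {fst b, fst b + 1} \<times> {snd b, snd b + 1}"

definition face_of :: "pixel set \<Rightarrow> pixel \<Rightarrow> pixel option" where
  "face_of D b = (if block b \<subseteq> D then Some b else None)"

definition boundary_graph :: "pixel set \<Rightarrow> (pixel option, edge) multigraph" where
  "boundary_graph D = \<lparr>verts = (\<lambda>x. {x}) ` range (face_of D),
                       edges = edges (adjacency_graph D),
                       ends = (\<lambda>e. {{face_of D b} | b. e \<subseteq> block b})\<rparr>"

text \<open>A level is a pair of dual graphs. Contraction in one graph is accompanied by removal in the
  other, which preserves duality, so the embedding of every level is the one inherited from
  the base level. The receptive field of a vertex of the adjacency graph is the vertex itself.\<close>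

type_synonym level = "(pixel, edge) multigraph \<times> (pixel option, edge) multigraph"

definition base_level :: "image \<Rightarrow> level" where
  "base_level I = (adjacency_graph (pixels I), boundary_graph (pixels I))"

definition contract_adjacency :: "edge set \<Rightarrow> level \<Rightarrow> level" where
  "contract_adjacency S L = (contract S (fst L), remove S (snd L))"

definition contract_boundary :: "edge set \<Rightarrow> level \<Rightarrow> level" where
  "contract_boundary S L = (remove S (fst L), contract S (snd L))"

text \<open>The faces of the boundary graph are the vertices of the adjacency graph.\<close>

definition face_boundary :: "level \<Rightarrow> pixel set \<Rightarrow> edge set" where
  "face_boundary L v = {e \<in> edges (snd L). v \<in> ends (fst L) e}"

definition admissible_kernels :: "pixel set \<Rightarrow> (pixel, edge) multigraph \<Rightarrow> edge set \<Rightarrow> bool" where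
  "admissible_kernels F G T \<longleftrightarrow> T \<noteq> {} \<and> forest G T \<and>
     (\<forall>e\<in>T. \<forall>u\<in>ends G e. \<forall>v\<in>ends G e. u \<subseteq> F \<longleftrightarrow> v \<subseteq> F)"

definition degree2 :: "('a, 'e) multigraph \<Rightarrow> 'a set set" where
  "degree2 G = {v \<in> verts G. degree G v = 2}"

text \<open>One distinct incident edge for each vertex of degree 2. If the boundary graph, which is
  connected, has only vertices of degree 2, then it is a cycle, whose edges cannot all be
  contracted; one vertex is then left without an edge.\<close>

definition degree2_choice :: "('a, 'e) multigraph \<Rightarrow> 'e set \<Rightarrow> bool" where
  "degree2_choice G R \<longleftrightarrow>
     (\<exists>W c. (W = degree2 G \<or> degree2 G = verts G \<and> (\<exists>v\<in>verts G. W = verts G - {v})) \<and>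
            inj_on c W \<and> (\<forall>v\<in>W. c v \<in> edges G \<and> v \<in> ends G (c v)) \<and>
            R = c ` W \<and> forest G R)"

definition pyramid_step :: "pixel set \<Rightarrow> level \<Rightarrow> edge set \<Rightarrow> level \<Rightarrow> bool" where
  "pyramid_step F L T L' \<longleftrightarrow> admissible_kernels F (fst L) T \<and>
     (let L1 = contract_adjacency T L;
          L2 = contract_boundary (pendant (snd L1)) L1
      in \<exists>R. degree2_choice (snd L2) R \<and> L' = contract_boundary R L2)"

definition surviving_vertices ::
    "(pixel, edge) multigraph \<Rightarrow> edge set \<Rightarrow> pixel set set \<Rightarrow> bool" where
  "surviving_vertices G T R \<longleftrightarrow> R \<subseteq> verts G \<and>
     (\<forall>v\<in>verts G. \<exists>!r. r \<in> R \<and> (v, r) \<in> (link G T)\<^sup>*)"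

record pyramid =
  height :: nat
  level :: "nat \<Rightarrow> level"
  kernels :: "nat \<Rightarrow> edge set"
  survivors :: "nat \<Rightarrow> pixel set set"

definition pyramid_on :: "image \<Rightarrow> pyramid \<Rightarrow> bool" where
  "pyramid_on I P \<longleftrightarrow> level P 0 = base_level I \<and>
     (\<forall>k < height P.
        pyramid_step (fg I) (level P k) (kernels P k) (level P (Suc k)) \<and>
        surviving_vertices (fst (level P k)) (kernels P k) (survivors P k)) \<and>
     (\<nexists>T. admissible_kernels (fg I) (fst (level P (height P))) T)"

text \<open>The vertex set and the edge set of the equivalent contraction kernel of a vertex \<open>v\<close> of
  the top level.\<close>

definition eck :: "pyramid \<Rightarrow> pixel set \<Rightarrow> pixel set \<times> edge set" where
  "eck P v = (v, {e \<in> (\<Union>k < height P. kernels P k). e \<subseteq> v})"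


section \<open>The homology-generator level and down projection\<close>

text \<open>\<open>S\<close> is the spanning tree of the top boundary graph whose edges are contracted.\<close>

definition generator_level :: "pyramid \<Rightarrow> edge set \<Rightarrow> level" where
  "generator_level P S = contract_boundary S (level P (height P))"

definition object_faces :: "image \<Rightarrow> level \<Rightarrow> pixel set set" where
  "object_faces I L = {v \<in> verts (fst L). v \<subseteq> fg I}"

text \<open>In the generator level the adjacency graph is dual to a one-vertex graph, hence a tree;
  being bipartite between \<open>f\<close> and the background regions, it is a star. So a self-loop of the
  boundary graph has \<open>f\<close> on one side and just one background region \<open>R\<close> on the other: it
  surrounds \<open>R\<close> if \<open>R\<close> is a hole, and \<open>f\<close> if \<open>R\<close> is the outer region.\<close>

definition loop_between :: "level \<Rightarrow> pixel set \<Rightarrow> pixel set \<Rightarrow> edge \<Rightarrow> bool" where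
  "loop_between L f R e \<longleftrightarrow> e \<in> face_boundary L f \<and> ends (fst L) e = {f, R}"

text \<open>\<open>v\<close> is the starting vertex of \<open>e\<close> when the edges of the kernels \<open>T\<close> are oriented toward
  the roots \<open>R\<close>: without \<open>e\<close> no root can be reached from \<open>v\<close>.\<close>

definition starts :: "('a, 'e) multigraph \<Rightarrow> 'e set \<Rightarrow> 'a set set \<Rightarrow> 'e \<Rightarrow> 'a set \<Rightarrow> bool" where
  "starts G T R e v \<longleftrightarrow> e \<in> T \<and> v \<in> ends G e \<and> (\<forall>r\<in>R. (v, r) \<notin> (link G (T - {e}))\<^sup>*)"

definition children :: "('a, 'e) multigraph \<Rightarrow> 'e set \<Rightarrow> 'a set set \<Rightarrow> 'a set \<Rightarrow> 'a set set" where
  "children G T R v = {w. w \<noteq> v \<and> (\<exists>e. starts G T R e w \<and> v \<in> ends G e)}"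

inductive has_label ::
    "level \<Rightarrow> edge set \<Rightarrow> pixel set set \<Rightarrow> edge set \<Rightarrow> pixel set \<Rightarrow> nat \<Rightarrow> bool"
  for L :: level and T :: "edge set" and R :: "pixel set set" and A :: "edge set" where
  label: "has_label L T R A v (card (A \<inter> face_boundary L v) + (\<Sum>w\<in>children (fst L) T R v. l w))"
  if "v \<in> verts (fst L)" "v \<notin> R"
     "\<And>w. w \<in> children (fst L) T R v \<Longrightarrow> has_label L T R A w (l w)"

text \<open>From \<open>A\<close> on level \<open>k + 1\<close> to level \<open>k\<close>. As edges keep their names, the edges of level \<open>k\<close>
  that survive to those in \<open>A\<close> are the edges of level \<open>k\<close> in \<open>A\<close>.\<close>

definition down_step :: "pixel set \<Rightarrow> pyramid \<Rightarrow> nat \<Rightarrow> edge set \<Rightarrow> edge set" where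
  "down_step F P k A =
     (let L = level P k; T = kernels P k; R = survivors P k;
          As = A \<inter> edges (snd L);
          Ar = {e \<in> T. \<exists>v m. v \<subseteq> F \<and> starts (fst L) T R e v \<and> has_label L T R As v m \<and> odd m}
      in As \<union> Ar)"

primrec project_down :: "pixel set \<Rightarrow> pyramid \<Rightarrow> nat \<Rightarrow> edge set \<Rightarrow> edge set" where
  "project_down F P 0 A = A"
| "project_down F P (Suc k) A = project_down F P k (down_step F P k A)"

definition down_projected_cocycle :: "image \<Rightarrow> pyramid \<Rightarrow> edge \<Rightarrow> edge \<Rightarrow> edge set" where
  "down_projected_cocycle I P \<alpha> \<beta> = project_down (fg I) P (height P) {\<alpha>, \<beta>}"

end

theory Submission
  imports Defs
begin

text \<open>A down-projected cocycle \<open>A\<^sub>0\<close> consists of the two loops \<open>\<alpha>, \<beta>\<close> and of edges of the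
  equivalent contraction kernel. The labels are chosen so that at every level \<open>A\<^sub>k\<close> meets the
  boundary of every object face in an even number of edges: away from the roots this is the
  definition of the labels, and at a root it is inherited from the face of the level above
  into which the kernel is merged. Since the equivalent contraction kernel is a forest, and
  since a nonempty forest always has a vertex of odd degree, \<open>\<alpha>\<close>, \<open>\<beta>\<close> and the kernel determine
  \<open>A\<^sub>0\<close>. It remains to see that the loops correspond under the rotation, that is, that at the
  generator level the object and a background region share only one edge. Two such edges would
  close up, along contracted edges, to a cycle in the pixel grid. By a parity version of the
  Jordan curve theorem it would separate the faces of the grid, but these are connected by
  boundary edges that are contracted and hence not on the cycle.\<close>

text \<open>The two pyramids may differ in height, kernels and roots, so there is no level-by-level
  comparison of \<open>P\<close> and \<open>P'\<close>. Each down projection is instead pinned down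
  by conditions on the base grid alone, in which neither levels nor roots occur. Two obstacles shape
  the bookkeeping. A removal edge joins two faces of its kernel but lies inside the merged face of
  the next level; counting ends of edges at pixels instead of edges around faces makes it contribute
  0 or 2 there, so that parities add up over a merged face. And hypothesis (b) is only an equality
  of edge sets, with no matching of individual edges; the Jordan-type argument is what turns it into
  a matching of the loops. There the disjointness of the two kinds of contracted edges acts as in a
  tree-cotree decomposition: primal paths within receptive fields never cross the dual paths that
  join the faces of the grid.\<close>

section \<open>Reachability and connected components\<close>

definition reach :: "('e \<Rightarrow> 'a set) \<Rightarrow> 'e set \<Rightarrow> ('a \<times> 'a) set" where
  "reach en S = {(u, v). \<exists>e\<in>S. en e = {u, v}}\<^sup>*"

lemma link_rtrancl: "(link G S)\<^sup>* = reach (ends G) S"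
  by (simp add: link_def reach_def)

lemma reach_refl [simp]: "(u, u) \<in> reach en S"
  by (simp add: reach_def)

lemma reach_trans: "(u, v) \<in> reach en S \<Longrightarrow> (v, w) \<in> reach en S \<Longrightarrow> (u, w) \<in> reach en S"
  unfolding reach_def by (rule rtrancl_trans)

lemma reach_edge: "e \<in> S \<Longrightarrow> en e = {u, v} \<Longrightarrow> (u, v) \<in> reach en S"
  unfolding reach_def by blast

lemma reach_sym: "(u, v) \<in> reach en S \<Longrightarrow> (v, u) \<in> reach en S"
proof -
  have "sym {(u, v). \<exists>e\<in>S. en e = {u, v}}"
    by (auto simp: sym_def insert_commute)
  then show "(u, v) \<in> reach en S \<Longrightarrow> (v, u) \<in> reach en S"
    unfolding reach_def by (meson sym_rtrancl symD)
qed

lemma reach_mono: "S \<subseteq> S' \<Longrightarrow> (u, v) \<in> reach en S \<Longrightarrow> (u, v) \<in> reach en S'"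
  unfolding reach_def by (erule rtrancl_mono[THEN subsetD, rotated]) blast

lemma reach_induct [consumes 1, case_names refl step]:
  assumes "(u, v) \<in> reach en S" "P u"
    and "\<And>v w e. (u, v) \<in> reach en S \<Longrightarrow> e \<in> S \<Longrightarrow> en e = {v, w} \<Longrightarrow> P v \<Longrightarrow> P w"
  shows "P v"
  using assms(1) unfolding reach_def
proof (induction rule: rtrancl_induct)
  case base
  show ?case by fact
next
  case (step y z)
  then show ?case using assms(3)[of y _ z] unfolding reach_def by blast
qed

text \<open>Components are taken with respect to an ends map and an edge set, not a multigraph, so
  that base-level ends and the ends of a level can be compared. They serve as vertices of contracted
  graphs and, after deletion of an edge, as the sides of a bridge.\<close>

definition parts :: "('e \<Rightarrow> 'a set) \<Rightarrow> 'e set \<Rightarrow> 'a \<Rightarrow> 'a set" where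
  "parts en S p = reach en S `` {p}"

lemma parts_self [simp]: "p \<in> parts en S p"
  by (simp add: parts_def)

lemma parts_eq_iff: "parts en S p = parts en S q \<longleftrightarrow> (p, q) \<in> reach en S"
  unfolding parts_def set_eq_iff Image_singleton_iff by (meson reach_refl reach_sym reach_trans)

lemma parts_subset:
  assumes "p \<in> D" "\<And>e. e \<in> S \<Longrightarrow> en e \<subseteq> D"
  shows "parts en S p \<subseteq> D"
proof
  fix q assume "q \<in> parts en S p"
  then have "(p, q) \<in> reach en S" by (simp add: parts_def)
  then show "q \<in> D" by (induction rule: reach_induct) (use assms in blast)+
qed

section \<open>Parity of degrees\<close>

text \<open>The cycle space modulo 2. An edge is counted once at each of its ends; the edge sets
  that matter here contain no self-loops, for which this would differ from the usual degree.\<close>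

definition even_edges :: "('e \<Rightarrow> 'a set) \<Rightarrow> 'e set \<Rightarrow> bool" where
  "even_edges en B \<longleftrightarrow> finite B \<and> (\<forall>v. even (card {e \<in> B. v \<in> en e}))"

lemma handshake:
  assumes "finite B" "finite C"
  shows "(\<Sum>v\<in>C. card {e \<in> B. v \<in> en e}) = (\<Sum>e\<in>B. card (en e \<inter> C))"
proof -
  have "(\<Sum>v\<in>C. card {e \<in> B. v \<in> en e}) = (\<Sum>v\<in>C. \<Sum>e\<in>B. of_bool (v \<in> en e))"
    using assms by (intro sum.cong refl) (simp add: Int_def)
  also have "\<dots> = (\<Sum>e\<in>B. \<Sum>v\<in>C. of_bool (v \<in> en e))" by (rule sum.swap)
  also have "\<dots> = (\<Sum>e\<in>B. card (en e \<inter> C))"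
    using assms by (intro sum.cong refl) (simp add: Int_def conj_commute)
  finally show ?thesis .
qed

text \<open>For an edge with two distinct ends the term is odd exactly when the edge leaves
  \<open>C\<close>, so this is the fact that a cycle modulo 2 crosses every cut evenly
  often.\<close>

lemma even_edges_cut:
  assumes "even_edges en B" "finite C"
  shows "even (\<Sum>e\<in>B. card (en e \<inter> C))"
proof -
  have "even (\<Sum>v\<in>C. card {e \<in> B. v \<in> en e})"
    using assms(1) unfolding even_edges_def by (intro dvd_sum) blast
  then show ?thesis using assms handshake[of B C en] by (simp add: even_edges_def)
qed

lemma card_sym_diff_parity:
  assumes "finite A" "finite B"
  shows "even (card (sym_diff A B)) \<longleftrightarrow> (even (card A) \<longleftrightarrow> even (card B))"
proof -
  have "card A = card (A - B) + card (A \<inter> B)" "card B = card (B - A) + card (A \<inter> B)"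
    using assms by (metis card_Diff_subset_Int card_mono Int_lower1 finite_Int le_add_diff_inverse2,
        metis card_Diff_subset_Int card_mono Int_lower1 finite_Int le_add_diff_inverse2 Int_commute)
  moreover have "card (sym_diff A B) = card (A - B) + card (B - A)"
    using assms by (intro card_Un_disjoint) auto
  ultimately show ?thesis by auto
qed

lemma degree_sym_diff_parity:
  assumes "finite A" "finite B"
  shows "even (card {e \<in> sym_diff A B. v \<in> en e}) \<longleftrightarrow>
    (even (card {e \<in> A. v \<in> en e}) \<longleftrightarrow> even (card {e \<in> B. v \<in> en e}))"
proof -
  have "{e \<in> sym_diff A B. v \<in> en e} = sym_diff {e \<in> A. v \<in> en e} {e \<in> B. v \<in> en e}" by auto
  then show ?thesis
    using assms card_sym_diff_parity[of "{e \<in> A. v \<in> en e}" "{e \<in> B. v \<in> en e}"] by simp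
qed

text \<open>An edge of a forest is a bridge, and a nonempty even set would cross the cut given by
  one side of that bridge exactly once. This takes the place of finding a leaf.\<close>

lemma forest_even_edges_empty:
  assumes "forest G T" "B \<subseteq> T" "even_edges (ends G) B"
    and fin: "finite V" and en: "\<And>e. e \<in> T \<Longrightarrow> \<exists>u v. ends G e = {u, v} \<and> u \<in> V \<and> v \<in> V"
  shows "B = {}"
proof (rule ccontr)
  assume "B \<noteq> {}"
  then obtain e where e: "e \<in> B" by blast
  obtain u v where uv: "ends G e = {u, v}" "u \<in> V" "v \<in> V" using en[of e] e assms(2) by auto
  have nr: "(u, v) \<notin> reach (ends G) (T - {e})"
    using assms(1,2) e uv unfolding forest_def link_rtrancl by blast
  then have nr: "(u, v) \<notin> reach (ends G) (B - {e})"
    using reach_mono[of "B - {e}" "T - {e}" u v "ends G"] assms(2) by blast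
  \<comment> \<open>The side of \<open>u\<close> after deleting \<open>e\<close> from
    \<open>B\<close>: the other edges of \<open>B\<close> stay on one side, so \<open>e\<close>
    alone crosses.\<close>
  define C where "C = parts (ends G) (B - {e}) u"
  have "C \<subseteq> V" unfolding C_def by (rule parts_subset) (use uv en assms(2) in fastforce)+
  then have "finite C" using fin finite_subset by blast
  have finB: "finite B" using assms(3) by (simp add: even_edges_def)
  have C: "ends G e \<inter> C = {u}"
    using nr uv unfolding C_def parts_def by auto
  have "even (card (ends G g \<inter> C))" if "g \<in> B - {e}" for g
  proof -
    have "g \<in> T" using that assms(2) by blast
    then obtain x y where xy: "ends G g = {x, y}" using en by metis
    have ne: "x \<noteq> y" using assms(1) xy that assms(2) unfolding forest_def link_rtrancl
      by (metis DiffE reach_refl subset_eq)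
    have "(x, y) \<in> reach (ends G) (B - {e})"
      using reach_edge[of g "B - {e}" "ends G" x y, OF that xy] .
    then have "x \<in> C \<longleftrightarrow> y \<in> C" unfolding C_def parts_def Image_singleton_iff
      by (meson reach_sym reach_trans)
    then have "ends G g \<inter> C = {} \<or> ends G g \<inter> C = {x, y}" using xy by auto
    then show ?thesis by (rule disjE) (simp_all add: ne)
  qed
  then have "even (\<Sum>g\<in>B - {e}. card (ends G g \<inter> C))" by (intro dvd_sum) auto
  moreover have "(\<Sum>g\<in>B. card (ends G g \<inter> C)) = 1 + (\<Sum>g\<in>B - {e}. card (ends G g \<inter> C))"
    using sum.remove[OF finB e, of "\<lambda>g. card (ends G g \<inter> C)"] C by simp
  ultimately show False using even_edges_cut[OF assms(3) \<open>finite C\<close>] by simp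
qed

text \<open>The edges of a walk are added modulo 2, so repeated ones cancel and no simple path has
  to be extracted.\<close>

lemma reach_join:
  assumes "(p, q) \<in> reach en S" and ne: "\<And>e. e \<in> S \<Longrightarrow> card (en e) = 2"
  shows "\<exists>B\<subseteq>S. finite B \<and> (\<forall>v. odd (card {e \<in> B. v \<in> en e}) \<longleftrightarrow> (v = p) \<noteq> (v = q))"
  using assms(1)
proof (induction rule: reach_induct)
  case refl
  show ?case by (intro exI[of _ "{}"]) simp
next
  case (step v w e)
  then obtain B where B: "B \<subseteq> S" "finite B"
    "\<And>x. odd (card {e \<in> B. x \<in> en e}) \<longleftrightarrow> (x = p) \<noteq> (x = v)" by blast
  have "v \<noteq> w" using ne[OF step(2)] step(3) by auto
  have *: "odd (card {g \<in> {e}. x \<in> en g}) \<longleftrightarrow> (x = v) \<noteq> (x = w)" for x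
  proof -
    have "{g \<in> {e}. x \<in> en g} = (if x \<in> en e then {e} else {})" by auto
    then show ?thesis using step(3) \<open>v \<noteq> w\<close> by auto
  qed
  have "odd (card {g \<in> sym_diff B {e}. x \<in> en g}) \<longleftrightarrow> (x = p) \<noteq> (x = w)" for x
    using degree_sym_diff_parity[OF B(2), of "{e}" x en] B(3)[of x] *[of x] by auto
  then show ?case using B step(2) by (intro exI[of _ "sym_diff B {e}"]) auto
qed

section \<open>Composition of contractions\<close>

text \<open>Only the total set \<open>S\<close> of contracted edges matters, not its grouping into
  steps. Deletions change just \<open>edges G\<close>; ends are prescribed on all of
  \<open>E\<close>, so that deleted or contracted edges need no separate treatment.\<close>

definition quotient ::
    "('e \<Rightarrow> 'a set) \<Rightarrow> 'a set \<Rightarrow> 'e set \<Rightarrow> 'e set \<Rightarrow> ('a, 'e) multigraph \<Rightarrow> bool" where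
  "quotient en D E S G \<longleftrightarrow> (\<forall>e\<in>E. \<exists>p\<in>D. \<exists>q\<in>D. en e = {p, q}) \<and> S \<subseteq> E \<and> edges G \<subseteq> E \<and>
     verts G = parts en S ` D \<and> (\<forall>e\<in>E. ends G e = parts en S ` en e)"

lemma quotient_ends:
  assumes "quotient en D E S G" "e \<in> E"
  obtains p q where "p \<in> D" "q \<in> D" "en e = {p, q}" "ends G e = {parts en S p, parts en S q}"
proof -
  have Q: "\<forall>e\<in>E. \<exists>p\<in>D. \<exists>q\<in>D. en e = {p, q}" "\<forall>e\<in>E. ends G e = parts en S ` en e"
    using assms(1) by (simp_all add: quotient_def)
  from bspec[OF Q(1) assms(2)] obtain p q where pq: "p \<in> D" "q \<in> D" "en e = {p, q}"
    by blast
  from bspec[OF Q(2) assms(2)] have "ends G e = {parts en S p, parts en S q}"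
    unfolding pq(3) image_insert image_empty .
  with pq show thesis by (rule that)
qed

lemma quotient_verts: "quotient en D E S G \<Longrightarrow> verts G = parts en S ` D"
  by (simp add: quotient_def)

lemma quotient_contracted: "quotient en D E S G \<Longrightarrow> S \<subseteq> E"
  by (simp add: quotient_def)

lemma quotient_edges: "quotient en D E S G \<Longrightarrow> edges G \<subseteq> E"
  by (simp add: quotient_def)

lemma quotient_parts_subset:
  assumes Q: "quotient en D E S G" and "S' \<subseteq> E" "p \<in> D"
  shows "parts en S' p \<subseteq> D"
proof (rule parts_subset[OF \<open>p \<in> D\<close>])
  fix e assume "e \<in> S'"
  then have "e \<in> E" using assms(2) by blast
  then show "en e \<subseteq> D" using Q by (auto elim: quotient_ends)
qed

text \<open>A walk in the quotient lifts to the base by filling the gaps between consecutive edges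
  with walks along \<open>S\<close>; conversely, steps along \<open>S\<close> collapse.\<close>

lemma quotient_reach:
  assumes Q: "quotient en D E S G" and "S2 \<subseteq> E" and p: "p \<in> D"
  shows "(parts en S p, X) \<in> reach (ends G) S2 \<longleftrightarrow>
    (\<exists>q\<in>D. X = parts en S q \<and> (p, q) \<in> reach en (S \<union> S2))"
proof
  assume "(parts en S p, X) \<in> reach (ends G) S2"
  then show "\<exists>q\<in>D. X = parts en S q \<and> (p, q) \<in> reach en (S \<union> S2)"
  proof (induction rule: reach_induct)
    case refl
    then show ?case using p by auto
  next
    case (step Y Z e)
    then obtain q where q: "q \<in> D" "Y = parts en S q" "(p, q) \<in> reach en (S \<union> S2)" by blast
    have "e \<in> E" using step assms by blast
    then obtain a b where ab: "a \<in> D" "b \<in> D" "en e = {a, b}" "{Y, Z} = {parts en S a, parts en S b}"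
      using quotient_ends[OF Q] step(3) by metis
    \<comment> \<open>\<open>ends G e\<close> is an unordered pair, so the step is proved for one
      assignment of its ends and reused for the other.\<close>
    have main: ?case if "Y = parts en S a" "Z = parts en S b" "en e = {a, b}" "b \<in> D" for a b
    proof -
      have "(q, a) \<in> reach en S" using that q parts_eq_iff by metis
      then have "(q, a) \<in> reach en (S \<union> S2)" by (rule reach_mono[rotated]) simp
      moreover have "(a, b) \<in> reach en (S \<union> S2)"
        using reach_edge[of e "S \<union> S2" en a b] step(2) that by simp
      ultimately have "(p, b) \<in> reach en (S \<union> S2)" using q(3) by (blast intro: reach_trans)
      then show ?thesis using that by blast
    qed
    from ab(4) consider "Y = parts en S a" "Z = parts en S b" | "Y = parts en S b" "Z = parts en S a"
      by (auto simp: doubleton_eq_iff)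
    then show ?case using main ab by cases (auto simp: insert_commute)
  qed
next
  assume "\<exists>q\<in>D. X = parts en S q \<and> (p, q) \<in> reach en (S \<union> S2)"
  then obtain q where q: "X = parts en S q" and pq: "(p, q) \<in> reach en (S \<union> S2)" by blast
  from pq have "(parts en S p, parts en S q) \<in> reach (ends G) S2"
  proof (induction rule: reach_induct)
    case refl
    then show ?case by simp
  next
    case (step v w e)
    show ?case
    proof (cases "e \<in> S")
      case True
      then have "parts en S v = parts en S w" unfolding parts_eq_iff
        using reach_edge[of e S en v w] step(3) by simp
      then show ?thesis using step by simp
    next
      case False
      then have e: "e \<in> S2" using step by blast
      then have "e \<in> E" using assms by blast
      then have "ends G e = {parts en S v, parts en S w}"
        using Q step(3) by (simp add: quotient_def)
      then show ?thesis
        using step(4) reach_edge[of e S2 "ends G"] e by (metis reach_trans)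
    qed
  qed
  then show "(parts en S p, X) \<in> reach (ends G) S2" using q by simp
qed

lemma quotient_merged:
  assumes Q: "quotient en D E S G" and "S2 \<subseteq> E" and p: "p \<in> D"
  shows "merged G S2 (parts en S p) = parts en (S \<union> S2) p"
proof
  show "merged G S2 (parts en S p) \<subseteq> parts en (S \<union> S2) p"
  proof
    fix x assume "x \<in> merged G S2 (parts en S p)"
    then obtain w where w: "x \<in> w" "(parts en S p, w) \<in> reach (ends G) S2"
      unfolding merged_def link_rtrancl by blast
    then obtain q where q: "w = parts en S q" "(p, q) \<in> reach en (S \<union> S2)"
      using quotient_reach[OF assms] by blast
    then have "(q, x) \<in> reach en S" using w by (simp add: parts_def)
    then have "(q, x) \<in> reach en (S \<union> S2)" by (rule reach_mono[rotated]) simp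
    then show "x \<in> parts en (S \<union> S2) p"
      using q unfolding parts_def Image_singleton_iff by (meson reach_trans)
  qed
  show "parts en (S \<union> S2) p \<subseteq> merged G S2 (parts en S p)"
  proof
    fix x assume x: "x \<in> parts en (S \<union> S2) p"
    have "parts en (S \<union> S2) p \<subseteq> D"
      using quotient_parts_subset[OF Q] quotient_contracted[OF Q] p assms(2) by simp
    then have xD: "x \<in> D" using x by blast
    have "(parts en S p, parts en S x) \<in> reach (ends G) S2"
      using quotient_reach[OF assms] xD x by (auto simp: parts_def)
    moreover have "parts en S x \<in> verts G" using xD by (simp add: quotient_verts[OF Q])
    ultimately have "parts en S x \<in> {w \<in> verts G. (parts en S p, w) \<in> reach (ends G) S2}"
      by simp
    then show "x \<in> merged G S2 (parts en S p)"
      unfolding merged_def link_rtrancl by (rule UnionI) simp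
  qed
qed

text \<open>Contracting \<open>S\<close> and then \<open>S2\<close> amounts to contracting their
  union, so a single set of base-level edges describes a level of any height.\<close>

lemma quotient_contract:
  assumes Q: "quotient en D E S G" and "S2 \<subseteq> E"
  shows "quotient en D E (S \<union> S2) (contract S2 G)"
proof -
  have *: "merged G S2 ` parts en S ` X = parts en (S \<union> S2) ` X" if "X \<subseteq> D" for X
    unfolding image_image
    by (rule image_cong[OF refl]) (use quotient_merged[OF assms] that in blast)
  have "verts (contract S2 G) = parts en (S \<union> S2) ` D"
    using *[of D] quotient_verts[OF Q] by (simp add: contract_def)
  moreover have "ends (contract S2 G) e = parts en (S \<union> S2) ` en e" if e: "e \<in> E" for e
  proof -
    obtain p q where "p \<in> D" "q \<in> D" "en e = {p, q}" using quotient_ends[OF Q e] .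
    then have "en e \<subseteq> D" by simp
    then show ?thesis using * Q e by (simp add: contract_def quotient_def)
  qed
  moreover have "edges (contract S2 G) \<subseteq> E"
    using quotient_edges[OF Q] by (auto simp: contract_def)
  ultimately show ?thesis using Q assms(2) by (simp add: quotient_def)
qed

lemma quotient_remove: "quotient en D E S G \<Longrightarrow> quotient en D E S (remove S2 G)"
  by (auto simp: quotient_def remove_def)

text \<open>Acyclicity in terms of the cycle space, which is easier to transfer between the base and
  a quotient than the bridge condition of \<open>forest\<close>.\<close>

definition even_free :: "('e \<Rightarrow> 'a set) \<Rightarrow> 'e set \<Rightarrow> bool" where
  "even_free en S \<longleftrightarrow> (\<forall>B\<subseteq>S. even_edges en B \<longrightarrow> B = {})"

text \<open>Sum the base degrees of an even set \<open>B\<close> over a vertex \<open>v\<close> of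
  the quotient: edges of \<open>S\<close> contribute 0 or 2, the others 1 exactly when
  \<open>v\<close> is an end. So \<open>B - S\<close> is even in the quotient, hence empty because
  \<open>T\<close> is a forest there, and \<open>B\<close> lies in \<open>S\<close>.\<close>

lemma even_free_Un_forest:
  assumes Q: "quotient en D E S G" and two: "\<And>e. e \<in> E \<Longrightarrow> card (en e) = 2" and "finite D"
    and S: "even_free en S" and T: "forest G T"
  shows "even_free en (S \<union> T)"
  unfolding even_free_def
proof (intro allI impI)
  fix B assume B: "B \<subseteq> S \<union> T" "even_edges en B"
  then have finB: "finite B" by (simp add: even_edges_def)
  have TE: "T \<subseteq> E" using T Q by (auto simp: forest_def quotient_def)
  have nl: "parts en S p \<noteq> parts en S q" if "e \<in> T" "ends G e = {parts en S p, parts en S q}" for e p q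
    using T that unfolding forest_def link_rtrancl by (metis reach_refl)
  have "even (card {e \<in> B - S. v \<in> ends G e})" for v
  proof (cases "v \<in> verts G")
    case False
    have "v \<notin> ends G e" if "e \<in> B - S" for e
    proof -
      have "e \<in> E" using that B(1) TE by blast
      then obtain p q where "p \<in> D" "q \<in> D" "ends G e = {parts en S p, parts en S q}"
        using quotient_ends[OF Q] by metis
      then show ?thesis using False quotient_verts[OF Q] by auto
    qed
    then have "{e \<in> B - S. v \<in> ends G e} = {}" by blast
    then show ?thesis by (simp only: card.empty even_zero)
  next
    case True
    then obtain x where x: "x \<in> D" "v = parts en S x" using quotient_verts[OF Q] by blast
    have vD: "v \<subseteq> D" unfolding x(2)
      using quotient_parts_subset[OF Q] quotient_contracted[OF Q] x(1) by simp
    have finv: "finite v" using vD assms(3) finite_subset by blast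
    have in_v: "p \<in> v \<longleftrightarrow> parts en S p = v" for p
      unfolding x(2) parts_eq_iff by (auto simp: parts_def intro: reach_sym)
    have 1: "even (card (en e \<inter> v))" if "e \<in> B \<inter> S" for e
    proof -
      have e: "e \<in> E" using that quotient_contracted[OF Q] by blast
      obtain p q where pq: "en e = {p, q}" using quotient_ends[OF Q e] by metis
      have "p \<noteq> q" using two[OF e] pq by auto
      moreover have "parts en S p = parts en S q"
        using that pq reach_edge[of e S en p q] unfolding parts_eq_iff by simp
      then have "p \<in> v \<longleftrightarrow> q \<in> v" using in_v by simp
      then have "en e \<inter> v = {} \<or> en e \<inter> v = {p, q}" using pq by auto
      ultimately show ?thesis by (elim disjE) simp_all
    qed
    have 2: "card (en e \<inter> v) = of_bool (v \<in> ends G e)" if "e \<in> B - S" for e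
    proof -
      have eT: "e \<in> T" using that B by blast
      obtain p q where pq: "en e = {p, q}" "ends G e = {parts en S p, parts en S q}"
        using quotient_ends[OF Q] eT TE by (metis subsetD)
      have "parts en S p \<noteq> parts en S q" using nl eT pq by blast
      then have "p \<notin> v \<or> q \<notin> v" using in_v by auto
      then have "en e \<inter> v = (if p \<in> v then {p} else if q \<in> v then {q} else {})" using pq by auto
      then show ?thesis using pq in_v by auto
    qed
    have "(\<Sum>e\<in>B. card (en e \<inter> v)) = (\<Sum>e\<in>B \<inter> S. card (en e \<inter> v)) + (\<Sum>e\<in>B - S. card (en e \<inter> v))"
      using sum.Int_Diff[OF finB] by blast
    moreover have "even (\<Sum>e\<in>B \<inter> S. card (en e \<inter> v))" using 1 by (intro dvd_sum) auto
    moreover have "(\<Sum>e\<in>B - S. card (en e \<inter> v)) = card {e \<in> B - S. v \<in> ends G e}"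
    proof -
      have "(\<Sum>e\<in>B - S. card (en e \<inter> v)) = (\<Sum>e\<in>B - S. of_bool (v \<in> ends G e))"
        using 2 by (intro sum.cong) auto
      also have "\<dots> = card {e \<in> B - S. v \<in> ends G e}" using finB
        by (simp add: Int_def)
      finally show ?thesis .
    qed
    ultimately show ?thesis using even_edges_cut[OF B(2) finv] by presburger
  qed
  then have "even_edges (ends G) (B - S)" using finB by (simp add: even_edges_def)
  moreover have "finite (verts G)" using quotient_verts[OF Q] assms(3) by simp
  moreover have "\<exists>u v. ends G e = {u, v} \<and> u \<in> verts G \<and> v \<in> verts G" if "e \<in> T" for e
  proof -
    have "e \<in> E" using that TE by blast
    then obtain p q where "p \<in> D" "q \<in> D" "en e = {p, q}"
      "ends G e = {parts en S p, parts en S q}" by (rule quotient_ends[OF Q])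
    then show ?thesis unfolding quotient_verts[OF Q] by blast
  qed
  moreover have "B - S \<subseteq> T" using B(1) by blast
  ultimately have "B - S = {}" by (intro forest_even_edges_empty[OF T])
  then have "B \<subseteq> S" by blast
  then show "B = {}" using S B(2) unfolding even_free_def by simp
qed

section \<open>Rooted forests\<close>

lemma reach_isolated:
  assumes "(r, v) \<in> reach en {e \<in> T. v \<notin> en e}"
  shows "v = r"
proof -
  have "y = r \<or> y \<noteq> v" if "(r, y) \<in> reach en {e \<in> T. v \<notin> en e}" for y
    using that by (induction rule: reach_induct) auto
  then show ?thesis using assms by blast
qed

text \<open>The edge in the second alternative is the one by which a walk from \<open>r\<close>
  first enters \<open>v\<close>. For a root \<open>r\<close> it becomes the parent edge of
  \<open>v\<close>.\<close>

lemma reach_leave: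
  assumes "(r, u) \<in> reach en T" and "v \<noteq> r"
  shows "(r, u) \<in> reach en {e \<in> T. v \<notin> en e} \<or>
    (\<exists>e\<in>T. \<exists>x. en e = {v, x} \<and> (r, x) \<in> reach en {e \<in> T. v \<notin> en e})"
  using assms(1)
proof (induction rule: reach_induct)
  case refl
  show ?case by simp
next
  case (step y z e)
  show ?case
  proof (cases "(r, y) \<in> reach en {e \<in> T. v \<notin> en e}")
    case True
    have "y \<noteq> v" using True reach_isolated assms(2) by metis
    show ?thesis
    proof (cases "z = v")
      case True
      then have "en e = {v, y}" using step(3) by (simp add: insert_commute)
      then show ?thesis using step(2) \<open>(r, y) \<in> reach en {e \<in> T. v \<notin> en e}\<close> by metis
    next
      case False
      then have "e \<in> {e \<in> T. v \<notin> en e}" using \<open>y \<noteq> v\<close> step(2,3) by simp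
      then have "(y, z) \<in> reach en {e \<in> T. v \<notin> en e}"
        by (rule reach_edge[of e _ en y z, OF _ step(3)])
      then show ?thesis by (rule disjI1[OF reach_trans[OF True]])
    qed
  next
    case False
    then show ?thesis using step(4) by (metis (no_types, lifting))
  qed
qed

locale rooted_forest =
  fixes G :: "(pixel, edge) multigraph" and T :: "edge set" and R :: "pixel set set"
  assumes forest: "forest G T" and surviving: "surviving_vertices G T R"
    and finite_verts: "finite (verts G)" and finite_edges: "finite (edges G)"
    and ends_verts: "\<And>e. e \<in> edges G \<Longrightarrow> \<exists>u v. ends G e = {u, v} \<and> u \<in> verts G \<and> v \<in> verts G"
begin

lemma T_edges: "T \<subseteq> edges G"
  using forest by (simp add: forest_def)

lemma T_finite: "finite T"
  using T_edges finite_edges by (rule finite_subset)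

lemma cut: "e \<in> T \<Longrightarrow> ends G e = {u, v} \<Longrightarrow> (u, v) \<notin> reach (ends G) (T - {e})"
  using forest by (simp add: forest_def link_rtrancl)

lemma ends_distinct: "e \<in> T \<Longrightarrow> ends G e = {u, v} \<Longrightarrow> u \<noteq> v"
  using cut reach_refl by metis

lemma root_ex: "v \<in> verts G \<Longrightarrow> \<exists>r\<in>R. (v, r) \<in> reach (ends G) T"
  using surviving unfolding surviving_vertices_def link_rtrancl by meson

lemma root_unique:
  "v \<in> verts G \<Longrightarrow> r \<in> R \<Longrightarrow> r' \<in> R \<Longrightarrow> (v, r) \<in> reach (ends G) T \<Longrightarrow>
    (v, r') \<in> reach (ends G) T \<Longrightarrow> r = r'"
  using surviving unfolding surviving_vertices_def link_rtrancl by blast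

lemma starts_not_root: "starts G T R e v \<Longrightarrow> v \<notin> R"
  unfolding starts_def by blast

lemma starts_edge: "starts G T R e v \<Longrightarrow> e \<in> T" and starts_end: "starts G T R e v \<Longrightarrow> v \<in> ends G e"
  unfolding starts_def by blast+

lemma T_ends:
  assumes "e \<in> T"
  obtains u v where "ends G e = {u, v}" "u \<in> verts G" "v \<in> verts G" "u \<noteq> v"
proof -
  have "e \<in> edges G" using assms T_edges by blast
  then obtain u v where "ends G e = {u, v}" "u \<in> verts G" "v \<in> verts G" using ends_verts by metis
  then show thesis using that ends_distinct assms by metis
qed

lemma starts_vert:
  assumes "starts G T R e v"
  shows "v \<in> verts G"
proof -
  obtain x y where "ends G e = {x, y}" "x \<in> verts G" "y \<in> verts G"
    using starts_edge[OF assms] by (rule T_ends)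
  then show ?thesis using starts_end[OF assms] by auto
qed

text \<open>\<open>starts\<close> has no built-in orientation. The parent edge is found as the entry
  edge of a walk from the root: deleting any other edge at \<open>v\<close> leaves the route through
  \<open>x\<close> to the root intact, and \<open>x\<close> keeps its own route when the parent edge
  is deleted.\<close>

lemma starts_parent:
  assumes v: "v \<in> verts G" "v \<notin> R"
  obtains e x where "ends G e = {v, x}" "starts G T R e v"
    "\<And>e'. starts G T R e' v \<Longrightarrow> e' = e" "\<not> starts G T R e x"
proof -
  obtain r where r: "r \<in> R" "(v, r) \<in> reach (ends G) T" using root_ex v(1) by blast
  have "v \<noteq> r" using r v by blast
  then have "(r, v) \<notin> reach (ends G) {e \<in> T. v \<notin> ends G e}"
    using reach_isolated[of r v "ends G" T] by blast
  then obtain e x where e: "e \<in> T" "ends G e = {v, x}"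
    and rx: "(r, x) \<in> reach (ends G) {e \<in> T. v \<notin> ends G e}"
    using reach_leave[OF reach_sym[OF r(2)] \<open>v \<noteq> r\<close>] by (elim disjE bexE exE conjE) simp_all
  \<comment> \<open>This route avoids \<open>v\<close>, hence every edge at
    \<open>v\<close>.\<close>
  have xr: "(x, r) \<in> reach (ends G) (T - {g})" if "v \<in> ends G g" for g
    using reach_sym[OF rx] by (rule reach_mono[rotated]) (use that in blast)
  have xre: "(x, r) \<in> reach (ends G) (T - {e})" using xr e by simp
  have "(v, r') \<notin> reach (ends G) (T - {e})" if "r' \<in> R" for r'
  proof
    assume a: "(v, r') \<in> reach (ends G) (T - {e})"
    then have "(v, r') \<in> reach (ends G) T" by (rule reach_mono[rotated]) blast
    then have "r' = r" using root_unique v r that by metis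
    then have "(v, x) \<in> reach (ends G) (T - {e})"
      using reach_trans[OF a] reach_sym[OF xre] by simp
    then show False using cut e by metis
  qed
  then have "starts G T R e v" using e by (simp add: starts_def link_rtrancl)
  moreover have "e' = e" if "starts G T R e' v" for e'
  proof (rule ccontr)
    assume "e' \<noteq> e"
    then have "e \<in> T - {e'}" using e by blast
    then have "(v, x) \<in> reach (ends G) (T - {e'})"
      by (rule reach_edge[of e _ "ends G" v x, OF _ e(2)])
    moreover have "(x, r) \<in> reach (ends G) (T - {e'})" using xr starts_end that by metis
    ultimately have "(v, r) \<in> reach (ends G) (T - {e'})" by (rule reach_trans)
    then show False using that r(1) by (simp add: starts_def link_rtrancl)
  qed
  moreover have "\<not> starts G T R e x" using xre r(1) by (auto simp: starts_def link_rtrancl)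
  ultimately show thesis using that e(2) by metis
qed

lemma starts_unique_edge: "starts G T R e v \<Longrightarrow> starts G T R e' v \<Longrightarrow> e = e'"
  using starts_parent[OF starts_vert starts_not_root] by metis

lemma starts_unique_vertex:
  assumes "starts G T R e u" "starts G T R e v"
  shows "u = v"
proof -
  obtain g x where g: "ends G g = {u, x}" "\<And>e'. starts G T R e' u \<Longrightarrow> e' = g"
    "\<not> starts G T R g x"
    using starts_parent[OF starts_vert[OF assms(1)] starts_not_root[OF assms(1)]] by metis
  have "e = g" using g(2) assms(1) by blast
  then show ?thesis using starts_end[OF assms(2)] g assms(2) by auto
qed

text \<open>If both ends kept a root after deletion of \<open>e\<close>, it would be the same root,
  and the two routes to it would bypass \<open>e\<close>.\<close>

lemma starts_ex:
  assumes "e \<in> T"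
  shows "\<exists>v. starts G T R e v"
proof (rule ccontr)
  assume "\<nexists>v. starts G T R e v"
  then have *: "\<exists>r\<in>R. (w, r) \<in> reach (ends G) (T - {e})" if "w \<in> ends G e" for w
    using assms that unfolding starts_def link_rtrancl by metis
  obtain u v where uv: "ends G e = {u, v}" "u \<in> verts G" using T_ends[OF assms] by metis
  obtain r where r: "r \<in> R" "(u, r) \<in> reach (ends G) (T - {e})"
    using * uv(1) by (metis insertI1 insertI2)
  obtain r' where r': "r' \<in> R" "(v, r') \<in> reach (ends G) (T - {e})"
    using * uv(1) by (metis insertI1 insertI2)
  have sub: "T - {e} \<subseteq> T" by blast
  have "(u, r') \<in> reach (ends G) T"
    using reach_trans[OF reach_edge[of e T "ends G", OF assms uv(1)] reach_mono[OF sub r'(2)]] .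
  then have "r' = r" using root_unique uv r r' reach_mono[OF sub r(2)] by metis
  then have "(u, v) \<in> reach (ends G) (T - {e})" using reach_trans[OF r(2)] reach_sym[OF r'(2)] by simp
  then show False using cut assms uv by metis
qed

lemma children_vert: "w \<in> children G T R v \<Longrightarrow> w \<in> verts G"
  and children_not_root: "w \<in> children G T R v \<Longrightarrow> w \<notin> R"
  unfolding children_def using starts_vert starts_not_root by blast+

lemma finite_children: "finite (children G T R v)"
  using children_vert finite_verts by (meson finite_subset subsetI)

lemma child_edge:
  assumes "c \<in> children G T R v" "starts G T R e c"
  shows "ends G e = {c, v}" "c \<noteq> v"
proof -
  obtain g where g: "c \<noteq> v" "starts G T R g c" "v \<in> ends G g"
    using assms(1) by (auto simp: children_def)
  have "g = e" using g(2) assms(2) starts_unique_edge by blast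
  obtain x y where "ends G e = {x, y}" using T_ends[OF starts_edge[OF assms(2)]] by metis
  then show "ends G e = {c, v}" using g \<open>g = e\<close> starts_end[OF assms(2)] by auto
  show "c \<noteq> v" by fact
qed

text \<open>The component on the side away from the root is the subtree below a vertex; its strict
  decrease toward children makes the recursion of the labels well-founded.\<close>

lemma child_side:
  assumes v: "starts G T R g v" and c: "c \<in> children G T R v" "starts G T R e c"
  shows "parts (ends G) (T - {e}) c \<subset> parts (ends G) (T - {g}) v"
proof -
  have e: "ends G e = {c, v}" "c \<noteq> v" using child_edge c by blast+
  have "e \<noteq> g" using starts_unique_vertex v c e by metis
  have eT: "e \<in> T" using c(2) by (rule starts_edge)
  have cv: "(c, v) \<notin> reach (ends G) (T - {e})" using cut eT e by blast
  have cy: "(c, y) \<in> reach (ends G) (T - {g})" if "(c, y) \<in> reach (ends G) (T - {e})" for y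
    using that
  proof (induction rule: reach_induct)
    case refl
    show ?case by simp
  next
    case (step y z h)
    have "(c, z) \<in> reach (ends G) (T - {e})"
      using reach_trans[OF step(1)] reach_edge[of h "T - {e}" "ends G" y z, OF step(2,3)] by blast
    \<comment> \<open>Using \<open>g\<close> would mean passing through \<open>v\<close>, which the
      deletion of \<open>e\<close> separates from \<open>c\<close>.\<close>
    then have "h \<noteq> g" using starts_end[OF v] cv step(1,3) by auto
    then have "h \<in> T - {g}" using step(2) by blast
    then show ?case
      using reach_trans[OF step(4)] reach_edge[of h "T - {g}" "ends G" y z, OF _ step(3)] by blast
  qed
  have "e \<in> T - {g}" using eT \<open>e \<noteq> g\<close> by blast
  then have "(v, c) \<in> reach (ends G) (T - {g})"
    by (rule reach_sym[OF reach_edge[of e _ "ends G" c v, OF _ e(1)]])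
  then have "parts (ends G) (T - {e}) c \<subseteq> parts (ends G) (T - {g}) v"
    unfolding parts_def Image_singleton using cy reach_trans by (metis (no_types, lifting) Collect_mono)
  moreover have "v \<in> parts (ends G) (T - {g}) v" "v \<notin> parts (ends G) (T - {e}) c"
    using cv by (simp_all add: parts_def)
  ultimately show ?thesis by blast
qed

lemma finite_side:
  assumes "v \<in> verts G"
  shows "finite (parts (ends G) (T - {g}) v)"
proof (rule finite_subset[OF parts_subset[OF assms] finite_verts])
  fix e assume "e \<in> T - {g}"
  then have "e \<in> T" by blast
  then obtain x y where "ends G e = {x, y}" "x \<in> verts G" "y \<in> verts G" by (rule T_ends)
  then show "ends G e \<subseteq> verts G" by simp
qed

end

section \<open>Existence, uniqueness and parity of labels\<close>

lemma has_label_unique: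
  assumes "has_label L T R A v m" "has_label L T R A v m'"
  shows "m = m'"
  using assms
proof (induction arbitrary: m' rule: has_label.induct)
  case (label v l)
  from label.prems show ?case
  proof cases
    case (label l')
    then show ?thesis using label.IH by (auto intro!: sum.cong)
  qed
qed

lemma (in rooted_forest) has_label_ex:
  assumes "G = fst L" "starts G T R g v"
  shows "\<exists>m. has_label L T R A v m"
  using assms(2)
proof (induction "card (parts (ends G) (T - {g}) v)" arbitrary: g v rule: less_induct)
  case less
  have "\<exists>m. has_label L T R A c m" if c: "c \<in> children G T R v" for c
  proof -
    obtain e where e: "starts G T R e c" using c by (auto simp: children_def)
    have "card (parts (ends G) (T - {e}) c) < card (parts (ends G) (T - {g}) v)"
      using child_side[OF less.prems c e] finite_side[OF starts_vert[OF less.prems]]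
      by (rule psubset_card_mono[rotated])
    then show ?thesis using less.hyps e by blast
  qed
  then obtain l where "\<And>c. c \<in> children G T R v \<Longrightarrow> has_label L T R A c (l c)" by metis
  then show ?case
    using has_label.label[of v L R T A l] starts_vert[OF less.prems] starts_not_root[OF less.prems]
    unfolding assms(1) by metis
qed

text \<open>Modulo 2, the label of \<open>w\<close> is the count of \<open>A\<close> around
  \<open>w\<close> plus the number of children with odd label. These children account for the chosen
  edges below \<open>w\<close>, and the parent edge is chosen iff the label of \<open>w\<close> is
  odd, which makes the total even.\<close>

lemma (in rooted_forest) label_parity_not_root:
  assumes L: "G = fst L" "edges (snd L) = edges G" and "finite A" "A \<inter> T = {}"
    and F: "\<And>e u v. e \<in> T \<Longrightarrow> u \<in> ends G e \<Longrightarrow> v \<in> ends G e \<Longrightarrow> u \<subseteq> F \<Longrightarrow> v \<subseteq> F"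
    and w: "w \<in> verts G" "w \<notin> R" "w \<subseteq> F"
    and B: "B = {e \<in> T. \<exists>v m. v \<subseteq> F \<and> starts G T R e v \<and> has_label L T R A v m \<and> odd m}"
  shows "even (card ((A \<union> B) \<inter> face_boundary L w))"
proof -
  have "\<exists>m. has_label L T R A v m" if "v \<in> verts G" "v \<notin> R" for v
    using that has_label_ex[OF L(1)] by (meson starts_parent)
  then obtain l where l: "\<And>v. v \<in> verts G \<Longrightarrow> v \<notin> R \<Longrightarrow> has_label L T R A v (l v)" by metis
  have "\<exists>e. starts G T R e v" if "v \<in> verts G" "v \<notin> R" for v
    using that by (meson starts_parent)
  then obtain pe where pe: "\<And>v. v \<in> verts G \<Longrightarrow> v \<notin> R \<Longrightarrow> starts G T R (pe v) v" by metis
  have Biff: "pe v \<in> B \<longleftrightarrow> odd (l v)" if v: "v \<in> verts G" "v \<notin> R" "v \<subseteq> F" for v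
  proof
    assume "pe v \<in> B"
    then obtain u m where u: "starts G T R (pe v) u" "has_label L T R A u m" "odd m"
      unfolding B by blast
    have "u = v" using starts_unique_vertex[OF u(1) pe] v by blast
    then have "m = l v" using has_label_unique u(2) l v by blast
    then show "odd (l v)" using u by blast
  next
    assume "odd (l v)"
    then show "pe v \<in> B" unfolding B using pe[OF v(1,2)] l[OF v(1,2)] v(3) starts_edge by blast
  qed
  define C where "C = children G T R w"
  have C: "c \<in> verts G" "c \<notin> R" if "c \<in> C" for c
    using that children_vert children_not_root unfolding C_def by blast+
  have peC: "ends G (pe c) = {c, w}" if "c \<in> C" for c
    using child_edge(1) that pe[OF C[OF that]] unfolding C_def by blast
  \<comment> \<open>Kernels do not mix object and background, so a foreground face has foreground
    children.\<close>
  have CF: "c \<subseteq> F" if "c \<in> C" for c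
    using F[OF starts_edge[OF pe[OF C[OF that]]], of w c] peC[OF that] w(3) by simp
  \<comment> \<open>The kernel edges at \<open>w\<close> are its own parent edge and the parent
    edges of its children.\<close>
  have eq: "B \<inter> face_boundary L w = (if odd (l w) then {pe w} else {}) \<union> pe ` {c \<in> C. odd (l c)}"
    (is "?X = ?Y")
  proof (intro equalityI subsetI)
    fix e assume e: "e \<in> ?X"
    then have eT: "e \<in> T" and we: "w \<in> ends G e" by (auto simp: B face_boundary_def L)
    obtain v where v: "starts G T R e v" using starts_ex[OF eT] by blast
    have vv: "v \<in> verts G" "v \<notin> R" using starts_vert[OF v] starts_not_root[OF v] .
    have ev: "e = pe v" using starts_unique_edge[OF v pe[OF vv]] .
    have "v \<subseteq> F" using F[OF eT we starts_end[OF v]] w(3) .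
    then have "odd (l v)" using Biff[OF vv] e ev by blast
    show "e \<in> ?Y"
    proof (cases "v = w")
      case True
      then show ?thesis using \<open>odd (l v)\<close> ev by simp
    next
      case False
      then have "v \<in> C" using v we unfolding C_def children_def by blast
      then show ?thesis using \<open>odd (l v)\<close> ev by blast
    qed
  next
    fix e assume "e \<in> ?Y"
    then consider "odd (l w)" "e = pe w" | c where "c \<in> C" "odd (l c)" "e = pe c"
      by (auto split: if_splits)
    then have "e \<in> B \<and> e \<in> T \<and> w \<in> ends G e"
    proof cases
      case 1
      then show ?thesis using Biff[OF w] pe[OF w(1,2)] starts_edge starts_end by blast
    next
      case 2
      then show ?thesis using Biff[OF C CF] pe[OF C] starts_edge peC by auto
    qed
    then show "e \<in> ?X" using T_edges by (auto simp: face_boundary_def L)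
  qed
  have inj: "inj_on pe C"
    using starts_unique_vertex pe C by (metis inj_onI)
  have "pe w \<notin> pe ` {c \<in> C. odd (l c)}"
  proof
    assume "pe w \<in> pe ` {c \<in> C. odd (l c)}"
    then obtain c where c: "c \<in> C" "pe w = pe c" by blast
    have "starts G T R (pe w) c" using pe[OF C[OF c(1)]] c(2) by simp
    then have "c = w" using pe[OF w(1,2)] by (rule starts_unique_vertex)
    then show False using c(1) by (simp add: C_def children_def)
  qed
  moreover have "card (pe ` {c \<in> C. odd (l c)}) = card {c \<in> C. odd (l c)}"
    by (rule card_image) (rule inj_on_subset[OF inj], blast)
  moreover have finC: "finite C" unfolding C_def by (rule finite_children)
  ultimately have cardB: "card (B \<inter> face_boundary L w) = of_bool (odd (l w)) + card {c \<in> C. odd (l c)}"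
    unfolding eq by simp
  have "has_label L T R A w (card (A \<inter> face_boundary L w) + (\<Sum>c\<in>C. l c))"
    unfolding C_def L(1) by (rule has_label.label)
      (use w L(1) l C in \<open>auto simp: C_def\<close>)
  then have lw: "l w = card (A \<inter> face_boundary L w) + (\<Sum>c\<in>C. l c)"
    using has_label_unique l w by blast
  have "even (\<Sum>c\<in>C. l c) \<longleftrightarrow> even (card {c \<in> C. odd (l c)})"
    using finC by (rule even_sum_iff)
  then have "even (card (A \<inter> face_boundary L w) + card (B \<inter> face_boundary L w))"
    unfolding cardB using lw by (cases "odd (l w)") auto
  moreover have "card ((A \<union> B) \<inter> face_boundary L w) =
      card (A \<inter> face_boundary L w) + card (B \<inter> face_boundary L w)"
  proof -
    have "B \<subseteq> T" unfolding B by blast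
    then have "finite B" "A \<inter> B = {}" using T_finite finite_subset assms(4) by blast+
    then show ?thesis unfolding Int_Un_distrib2 using \<open>finite A\<close> by (intro card_Un_disjoint) auto
  qed
  ultimately show ?thesis by simp
qed

section \<open>One step of down projection\<close>

text \<open>Counting at pixels makes the number additive over unions of disjoint faces. A grid edge
  inside \<open>v\<close> counts twice, hence not at all modulo 2.\<close>

definition incidences :: "edge set \<Rightarrow> pixel set \<Rightarrow> nat" where
  "incidences X v = (\<Sum>e\<in>X. card (e \<inter> v))"

lemma incidences_Un:
  "finite X \<Longrightarrow> finite Y \<Longrightarrow> X \<inter> Y = {} \<Longrightarrow> incidences (X \<union> Y) v = incidences X v + incidences Y v"
  unfolding incidences_def by (rule sum.union_disjoint)

lemma incidences_Union:
  assumes "finite K" "\<And>u. u \<in> K \<Longrightarrow> finite u" "\<And>u v. u \<in> K \<Longrightarrow> v \<in> K \<Longrightarrow> u \<noteq> v \<Longrightarrow> u \<inter> v = {}"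
  shows "incidences X (\<Union>K) = (\<Sum>u\<in>K. incidences X u)"
proof -
  have "card (e \<inter> \<Union>K) = (\<Sum>u\<in>K. card (e \<inter> u))" for e
  proof -
    have "e \<inter> \<Union>K = (\<Union>u\<in>K. e \<inter> u)" by blast
    also have "card \<dots> = (\<Sum>u\<in>K. card (e \<inter> u))"
      using assms by (intro card_UN_disjoint) blast+
    finally show ?thesis .
  qed
  then show ?thesis unfolding incidences_def by (simp add: sum.swap[of _ X K])
qed

lemma parts_iff_mem:
  assumes "v = parts en S x"
  shows "p \<in> v \<longleftrightarrow> parts en S p = v"
  unfolding assms parts_eq_iff unfolding parts_def Image_singleton_iff by (blast intro: reach_sym)

locale pixel_quotient =
  fixes D :: "pixel set" and E :: "edge set" and S :: "edge set" and G :: "(pixel, edge) multigraph"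
  assumes quotient: "quotient (\<lambda>e. e) D E S G" and card_edge: "\<And>e. e \<in> E \<Longrightarrow> card e = 2"
    and finite_pixels: "finite D"
begin

abbreviation part :: "pixel \<Rightarrow> pixel set" where
  "part \<equiv> parts (\<lambda>e. e) S"

lemma edge_ends:
  assumes "e \<in> E"
  obtains p q where "p \<in> D" "q \<in> D" "p \<noteq> q" "e = {p, q}" "ends G e = {part p, part q}"
proof -
  from assms obtain p q where pq: "p \<in> D" "q \<in> D" "e = {p, q}" "ends G e = {part p, part q}"
    by (rule quotient_ends[OF quotient])
  then have "p \<noteq> q" using card_edge[OF assms] by auto
  then show thesis using that pq by metis
qed

lemma finite_E: "finite E"
proof (rule finite_subset)
  show "E \<subseteq> Pow D"
  proof
    fix e assume "e \<in> E"
    then obtain p q where "p \<in> D" "q \<in> D" "p \<noteq> q" "e = {p, q}" "ends G e = {part p, part q}"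
      by (rule edge_ends)
    then show "e \<in> Pow D" by simp
  qed
  show "finite (Pow D)" using finite_pixels by simp
qed

lemma vert_iff_mem: "v \<in> verts G \<Longrightarrow> p \<in> v \<longleftrightarrow> part p = v"
  unfolding quotient_verts[OF quotient] by (erule imageE) (rule parts_iff_mem)

lemma vert_subset: "v \<in> verts G \<Longrightarrow> v \<subseteq> D"
  using quotient_parts_subset[OF quotient quotient_contracted[OF quotient]]
    quotient_verts[OF quotient] by auto

lemma vert_finite: "v \<in> verts G \<Longrightarrow> finite v"
  using vert_subset finite_pixels finite_subset by blast

lemma vert_disjoint: "u \<in> verts G \<Longrightarrow> v \<in> verts G \<Longrightarrow> u \<noteq> v \<Longrightarrow> u \<inter> v = {}"
  using vert_iff_mem by blast

lemma part_vert: "p \<in> D \<Longrightarrow> part p \<in> verts G"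
  by (simp add: quotient_verts[OF quotient])

lemma finite_verts: "finite (verts G)"
  by (simp add: quotient_verts[OF quotient] finite_pixels)

lemma rooted_forest_kernels:
  assumes "forest G T" "surviving_vertices G T R"
  shows "rooted_forest G T R"
proof
  show "finite (edges G)" using quotient_edges[OF quotient] finite_E by (rule finite_subset)
  show "\<exists>u v. ends G e = {u, v} \<and> u \<in> verts G \<and> v \<in> verts G" if "e \<in> edges G" for e
  proof -
    have "e \<in> E" using that quotient_edges[OF quotient] by blast
    then obtain p q where "p \<in> D" "q \<in> D" "p \<noteq> q" "e = {p, q}" "ends G e = {part p, part q}"
      by (rule edge_ends)
    then show ?thesis using part_vert by blast
  qed
qed (use assms finite_verts in auto)

text \<open>The labels are defined by counting edges around a face. As long as no edge lies inside
  \<open>v\<close>, that count agrees with the one by pixels.\<close>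

lemma incidences_eq_card:
  assumes X: "X \<subseteq> edges G" "\<And>e. e \<in> X \<Longrightarrow> \<not> e \<subseteq> v" and v: "v \<in> verts G"
    and L: "G = fst L" "edges (snd L) = edges G"
  shows "incidences X v = card (X \<inter> face_boundary L v)"
proof -
  have finX: "finite X" using X(1) quotient_edges[OF quotient] finite_E by (meson finite_subset)
  have "card (e \<inter> v) = of_bool (v \<in> ends G e)" if "e \<in> X" for e
  proof -
    have "e \<in> E" using that X(1) quotient_edges[OF quotient] by blast
    then obtain p q where pq: "p \<in> D" "q \<in> D" "p \<noteq> q" "e = {p, q}" "ends G e = {part p, part q}"
      by (rule edge_ends)
    have mem: "p \<in> v \<longleftrightarrow> part p = v" "q \<in> v \<longleftrightarrow> part q = v" using vert_iff_mem[OF v] by blast+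
    have "\<not> (p \<in> v \<and> q \<in> v)" using X(2)[OF that] pq(4) by blast
    then have "e \<inter> v = (if p \<in> v then {p} else if q \<in> v then {q} else {})"
      unfolding pq(4) by auto
    moreover have "v \<in> ends G e \<longleftrightarrow> p \<in> v \<or> q \<in> v" unfolding pq(5) mem by auto
    ultimately show ?thesis by simp
  qed
  then have "incidences X v = (\<Sum>e\<in>X. of_bool (v \<in> ends G e))"
    unfolding incidences_def by (rule sum.cong[OF refl])
  also have "\<dots> = card (X \<inter> {e. v \<in> ends G e})" using finX by simp
  also have "X \<inter> {e. v \<in> ends G e} = X \<inter> face_boundary L v"
    using X(1) L by (auto simp: face_boundary_def)
  finally show ?thesis .
qed

text \<open>Away from the roots, parity comes from the labels. At a root it follows by subtraction:
  the total over its kernel is the count on the merged face of the next level, where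
  \<open>A\<close> is even by assumption and every edge of \<open>B\<close> counts 0 or 2, and all
  other summands are even.\<close>

lemma down_level:
  assumes L: "G = fst L" "edges (snd L) = edges G"
    and T: "admissible_kernels F G T" and R: "surviving_vertices G T R"
    and A: "A \<subseteq> edges G" "A \<inter> T = {}"
    and A_loop: "\<And>e v. e \<in> A \<Longrightarrow> v \<in> verts (contract T G) \<Longrightarrow> \<not> e \<subseteq> v"
    and A_even: "\<And>v. v \<in> verts (contract T G) \<Longrightarrow> v \<subseteq> F \<Longrightarrow> even (incidences A v)"
    and B: "B = {e \<in> T. \<exists>v m. v \<subseteq> F \<and> starts G T R e v \<and> has_label L T R A v m \<and> odd m}"
  shows "\<And>e v. e \<in> A \<union> B \<Longrightarrow> v \<in> verts G \<Longrightarrow> \<not> e \<subseteq> v"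
    and "\<And>v. v \<in> verts G \<Longrightarrow> v \<subseteq> F \<Longrightarrow> even (incidences (A \<union> B) v)"
    and "\<And>e. e \<in> B \<Longrightarrow> e \<subseteq> F"
proof -
  have forest: "forest G T" using T by (simp add: admissible_kernels_def)
  interpret rooted_forest G T R using forest R by (rule rooted_forest_kernels)
  have TE: "T \<subseteq> E" using T_edges quotient_edges[OF quotient] by blast
  have AE: "A \<subseteq> E" using A(1) quotient_edges[OF quotient] by blast
  have B_T: "B \<subseteq> T" unfolding B by blast
  have fin: "finite A" "finite B"
    using AE finite_E B_T T_finite by (meson finite_subset)+
  have F: "v \<subseteq> F" if "e \<in> T" "u \<in> ends G e" "v \<in> ends G e" "u \<subseteq> F" for e u v
    using T that unfolding admissible_kernels_def by blast
  have contract_verts: "merged G T v \<in> verts (contract T G)" if "v \<in> verts G" for v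
    using that by (simp add: contract_def)
  have sub_merged: "v \<subseteq> merged G T v" if "v \<in> verts G" for v
    unfolding merged_def using that by blast
  \<comment> \<open>An edge of \<open>A\<close> leaves even the larger merged face; an edge of
    \<open>B\<close> belongs to a forest and so joins different vertices.\<close>
  show loop: "\<not> e \<subseteq> v" if e: "e \<in> A \<union> B" and v: "v \<in> verts G" for e v
  proof
    assume ev: "e \<subseteq> v"
    show False
    proof (cases "e \<in> A")
      case True
      then show False using A_loop contract_verts[OF v] sub_merged[OF v] ev by blast
    next
      case False
      then have eT: "e \<in> T" using e B_T by blast
      then have "e \<in> E" using TE by blast
      then obtain p q where pq: "p \<in> D" "q \<in> D" "p \<noteq> q" "e = {p, q}" "ends G e = {part p, part q}"
        by (rule edge_ends)
      have "part p = part q" using vert_iff_mem[OF v] ev pq(4) by simp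
      then show False using ends_distinct[OF eT pq(5)] by blast
    qed
  qed
  show "e \<subseteq> F" if e: "e \<in> B" for e
  proof -
    have eT: "e \<in> T" using e B_T by blast
    obtain v where v: "v \<subseteq> F" "starts G T R e v" using e unfolding B by blast
    have "e \<in> E" using eT TE by blast
    then obtain p q where pq: "p \<in> D" "q \<in> D" "p \<noteq> q" "e = {p, q}" "ends G e = {part p, part q}"
      by (rule edge_ends)
    have "part p \<subseteq> F" "part q \<subseteq> F"
      using F[OF eT starts_end[OF v(2)] _ v(1)] pq(5) by blast+
    then show ?thesis using parts_self[of p "\<lambda>e. e" S] parts_self[of q "\<lambda>e. e" S] pq(4) by blast
  qed
  have not_root: "even (incidences (A \<union> B) w)" if w: "w \<in> verts G" "w \<notin> R" "w \<subseteq> F" for w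
  proof -
    have "incidences (A \<union> B) w = card ((A \<union> B) \<inter> face_boundary L w)"
      using A(1) B_T T_edges loop w(1) L by (intro incidences_eq_card) auto
    moreover have "even (card ((A \<union> B) \<inter> face_boundary L w))"
      by (rule label_parity_not_root[OF L fin(1) A(2) F w B])
    ultimately show ?thesis by simp
  qed
  show "even (incidences (A \<union> B) w)" if w: "w \<in> verts G" "w \<subseteq> F" for w
  proof (cases "w \<in> R")
    case False
    then show ?thesis using not_root w by blast
  next
    case True
    \<comment> \<open>The kernel with root \<open>w\<close>; its union is a vertex of the next
      level.\<close>
    define K where "K = {u \<in> verts G. (w, u) \<in> reach (ends G) T}"
    have wK: "w \<in> K" using w by (simp add: K_def)
    have UK: "\<Union>K = merged G T w" by (simp add: K_def merged_def link_rtrancl)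
    have KF: "u \<subseteq> F" if "u \<in> K" for u
    proof -
      have "(w, u) \<in> reach (ends G) T" using that by (simp add: K_def)
      then show ?thesis
      proof (induction rule: reach_induct)
        case refl
        show ?case by fact
      next
        case (step u u' e)
        show ?case by (rule F[OF step(2) _ _ step(4)]) (simp_all add: step(3))
      qed
    qed
    have finK: "finite K" using finite_verts by (simp add: K_def)
    have memK: "p \<in> \<Union>K \<longleftrightarrow> part p \<in> K" if "p \<in> D" for p
      using vert_iff_mem parts_self[of p "\<lambda>e. e" S] unfolding K_def by auto
    have "even (card (e \<inter> \<Union>K))" if "e \<in> B" for e
    proof -
      have eT: "e \<in> T" using that B_T by blast
      then have "e \<in> E" using TE by blast
      then obtain p q where pq: "p \<in> D" "q \<in> D" "p \<noteq> q" "e = {p, q}" "ends G e = {part p, part q}"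
        by (rule edge_ends)
      have pq': "(part p, part q) \<in> reach (ends G) T"
        by (rule reach_edge[of e _ "ends G", OF eT pq(5)])
      have "part p \<in> K \<longleftrightarrow> part q \<in> K"
        unfolding K_def using part_vert pq(1,2) reach_trans[OF _ pq'] reach_trans[OF _ reach_sym[OF pq']]
        by blast
      then have "p \<in> \<Union>K \<longleftrightarrow> q \<in> \<Union>K" using memK pq(1,2) by blast
      then have "e \<inter> \<Union>K = {} \<or> e \<inter> \<Union>K = {p, q}" unfolding pq(4) by blast
      then show ?thesis by (rule disjE) (simp_all add: pq(3))
    qed
    then have "even (incidences B (\<Union>K))" unfolding incidences_def by (intro dvd_sum) blast
    moreover have "even (incidences A (\<Union>K))"
    proof (rule A_even)
      show "\<Union>K \<in> verts (contract T G)" unfolding UK by (rule contract_verts[OF w(1)])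
      show "\<Union>K \<subseteq> F" using KF by blast
    qed
    moreover have "A \<inter> B = {}" using A(2) B_T by blast
    ultimately have "even (incidences (A \<union> B) (\<Union>K))" using incidences_Un[OF fin] by simp
    moreover have "incidences (A \<union> B) (\<Union>K) = (\<Sum>u\<in>K. incidences (A \<union> B) u)"
      using finK vert_finite vert_disjoint by (intro incidences_Union) (auto simp: K_def)
    moreover have "(\<Sum>u\<in>K. incidences (A \<union> B) u) =
        incidences (A \<union> B) w + (\<Sum>u\<in>K - {w}. incidences (A \<union> B) u)"
      using finK wK by (rule sum.remove)
    moreover have "even (\<Sum>u\<in>K - {w}. incidences (A \<union> B) u)"
    proof (intro dvd_sum not_root)
      fix u assume u: "u \<in> K - {w}"
      then show "u \<in> verts G" "u \<subseteq> F" using KF by (auto simp: K_def)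
      show "u \<notin> R"
      proof
        assume "u \<in> R"
        then have "w = u" using root_unique[OF w(1) True] u by (simp add: K_def)
        then show False using u by blast
      qed
    qed
    ultimately show ?thesis by simp
  qed
qed

end

section \<open>Levels of a pyramid\<close>

definition grid_edges :: "pixel set \<Rightarrow> edge set" where
  "grid_edges D = {{p, q} | p q. p \<in> D \<and> q \<in> D \<and> adj4 p q}"

definition dual_ends :: "pixel set \<Rightarrow> edge \<Rightarrow> pixel option set" where
  "dual_ends D e = {face_of D b | b. e \<subseteq> block b}"

lemma adj4_cases:
  assumes "adj4 p q"
  obtains x y where "{p, q} = {(x, y), (x + 1, y)}" | x y where "{p, q} = {(x, y), (x, y + 1)}"
proof -
  obtain a b c d where pq: "p = (a, b)" "q = (c, d)" by (metis surj_pair)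
  then have "\<bar>a - c\<bar> + \<bar>b - d\<bar> = 1" using assms by (simp add: adj4_def)
  then consider "c = a + 1" "d = b" | "a = c + 1" "d = b" | "d = b + 1" "a = c" | "b = d + 1" "a = c"
    by linarith
  then show thesis
  proof cases
    case 1
    then show thesis using that(1)[of a b] pq by simp
  next
    case 2
    then show thesis using that(1)[of c b] pq by (simp add: insert_commute)
  next
    case 3
    then show thesis using that(2)[of a b] pq by simp
  next
    case 4
    then show thesis using that(2)[of a d] pq by (simp add: insert_commute)
  qed
qed

lemma block_iff: "(x, y) \<in> block (i, j) \<longleftrightarrow> (x = i \<or> x = i + 1) \<and> (y = j \<or> y = j + 1)"
  by (auto simp: block_def)

lemma dual_ends_horizontal:
  "dual_ends D {(x, y), (x + 1, y)} = {face_of D (x, y), face_of D (x, y - 1)}"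
proof -
  have "{(x, y), (x + 1, y)} \<subseteq> block b \<longleftrightarrow> b = (x, y) \<or> b = (x, y - 1)" for b
    by (cases b) (auto simp: block_iff)
  then show ?thesis unfolding dual_ends_def by auto
qed

lemma dual_ends_vertical:
  "dual_ends D {(x, y), (x, y + 1)} = {face_of D (x, y), face_of D (x - 1, y)}"
proof -
  have "{(x, y), (x, y + 1)} \<subseteq> block b \<longleftrightarrow> b = (x, y) \<or> b = (x - 1, y)" for b
    by (cases b) (auto simp: block_iff)
  then show ?thesis unfolding dual_ends_def by auto
qed

lemma parts_empty: "parts en {} p = {p}"
  by (auto simp: parts_def reach_def)

lemma grid_edge_card:
  assumes "e \<in> grid_edges D"
  shows "card e = 2"
proof -
  obtain p q where "e = {p, q}" "adj4 p q" using assms by (auto simp: grid_edges_def)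
  moreover from this have "p \<noteq> q" by (auto simp: adj4_def)
  ultimately show ?thesis by simp
qed

lemma quotient_adjacency_graph:
  "quotient (\<lambda>e. e) D (grid_edges D) {} (adjacency_graph D)"
  unfolding quotient_def
  by (auto simp: adjacency_graph_def grid_edges_def parts_empty)

text \<open>The two faces beside an edge may coincide: in an image one pixel wide, both are the
  unbounded face.\<close>

lemma quotient_boundary_graph:
  "quotient (dual_ends D) (range (face_of D)) (grid_edges D) {} (boundary_graph D)"
  unfolding quotient_def
proof (intro conjI ballI)
  fix e assume "e \<in> grid_edges D"
  then obtain p q where e: "e = {p, q}" "adj4 p q" by (auto simp: grid_edges_def)
  from adj4_cases[OF e(2)]
  have "\<exists>b c. dual_ends D e = {face_of D b, face_of D c}"
    unfolding e(1) using dual_ends_horizontal dual_ends_vertical by metis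
  then show "\<exists>x\<in>range (face_of D). \<exists>y\<in>range (face_of D). dual_ends D e = {x, y}" by blast
next
  fix e assume "e \<in> grid_edges D"
  show "ends (boundary_graph D) e = parts (dual_ends D) {} ` dual_ends D e"
    by (auto simp: boundary_graph_def dual_ends_def parts_empty)
qed (auto simp: boundary_graph_def adjacency_graph_def grid_edges_def parts_empty)

text \<open>\<open>A\<close> and \<open>C\<close> are the edges contracted so far in the adjacency
  graph and in the boundary graph. Contracting in one deletes in the other, so they are disjoint
  from each other and from the surviving edges. That \<open>A\<close> is a forest in the base grid
  is carried along for the uniqueness argument.\<close>

definition level_inv :: "pixel set \<Rightarrow> level \<Rightarrow> edge set \<Rightarrow> edge set \<Rightarrow> bool" where
  "level_inv D L A C \<longleftrightarrow>
     quotient (\<lambda>e. e) D (grid_edges D) A (fst L) \<and>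
     quotient (dual_ends D) (range (face_of D)) (grid_edges D) C (snd L) \<and>
     edges (snd L) = edges (fst L) \<and> A \<inter> C = {} \<and> edges (fst L) \<inter> (A \<union> C) = {} \<and>
     even_free (\<lambda>e. e) A"

lemma level_inv_base: "level_inv (pixels I) (base_level I) {} {}"
proof -
  have "even_free (\<lambda>e::edge. e) {}" by (auto simp: even_free_def)
  then show ?thesis
    using quotient_adjacency_graph quotient_boundary_graph
    by (simp add: level_inv_def base_level_def) (simp add: boundary_graph_def adjacency_graph_def)
qed

lemma level_inv_contract_adjacency:
  assumes L: "level_inv D L A C" and "finite D" and T: "forest (fst L) T"
  shows "level_inv D (contract_adjacency T L) (A \<union> T) C"
proof -
  have q: "quotient (\<lambda>e. e) D (grid_edges D) A (fst L)" using L by (simp add: level_inv_def)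
  have TL: "T \<subseteq> edges (fst L)" using T by (simp add: forest_def)
  then have "T \<subseteq> grid_edges D" using quotient_edges[OF q] by blast
  moreover have "even_free (\<lambda>e. e) (A \<union> T)"
    using even_free_Un_forest[OF q grid_edge_card \<open>finite D\<close> _ T] L by (simp add: level_inv_def)
  moreover have "edges (contract T (fst L)) = edges (fst L) - T" by (simp add: contract_def)
  moreover have "edges (remove T (snd L)) = edges (snd L) - T" by (simp add: remove_def)
  ultimately show ?thesis
    using L TL quotient_contract[OF q, of T] quotient_remove[of "dual_ends D" _ _ C "snd L" T]
    unfolding level_inv_def contract_adjacency_def fst_conv snd_conv by auto
qed

lemma level_inv_contract_boundary:
  assumes L: "level_inv D L A C" and X: "X \<subseteq> edges (snd L)"
  shows "level_inv D (contract_boundary X L) A (C \<union> X)"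
proof -
  have q: "quotient (dual_ends D) (range (face_of D)) (grid_edges D) C (snd L)"
    using L by (simp add: level_inv_def)
  then have "X \<subseteq> grid_edges D" using quotient_edges[OF q] X by blast
  moreover have "edges (contract X (snd L)) = edges (snd L) - X" by (simp add: contract_def)
  moreover have "edges (remove X (fst L)) = edges (fst L) - X" by (simp add: remove_def)
  ultimately show ?thesis
    using L X quotient_contract[OF q, of X] quotient_remove[of "\<lambda>e. e" _ _ A "fst L" X]
    unfolding level_inv_def contract_boundary_def fst_conv snd_conv by auto
qed

lemma pendant_subset: "pendant G \<subseteq> edges G"
proof
  fix e assume "e \<in> pendant G"
  then show "e \<in> edges G" by cases
qed

text \<open>Contractions in the boundary graph only delete adjacency edges, so receptive fields
  change through the kernels alone.\<close>

lemma pyramid_step_verts: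
  assumes "pyramid_step F L T L'"
  shows "verts (fst L') = verts (contract T (fst L))" and "edges (fst L') \<subseteq> edges (fst L) - T"
  using assms
  by (auto simp: pyramid_step_def Let_def contract_boundary_def contract_adjacency_def
      remove_def) (simp_all add: contract_def)

lemma level_inv_step:
  assumes L: "level_inv D L A C" and "finite D" and step: "pyramid_step F L T L'"
  shows "\<exists>C'. level_inv D L' (A \<union> T) C'"
proof -
  define L1 where "L1 = contract_adjacency T L"
  define L2 where "L2 = contract_boundary (pendant (snd L1)) L1"
  obtain X where X: "degree2_choice (snd L2) X" "L' = contract_boundary X L2"
    using step by (auto simp: pyramid_step_def Let_def L1_def L2_def)
  have "forest (fst L) T" using step by (simp add: pyramid_step_def admissible_kernels_def)
  then have "level_inv D L1 (A \<union> T) C"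
    unfolding L1_def using L \<open>finite D\<close> by (intro level_inv_contract_adjacency)
  then have "level_inv D L2 (A \<union> T) (C \<union> pendant (snd L1))"
    unfolding L2_def by (rule level_inv_contract_boundary) (rule pendant_subset)
  moreover have "X \<subseteq> edges (snd L2)" using X(1) by (auto simp: degree2_choice_def forest_def)
  ultimately have "level_inv D L' (A \<union> T) (C \<union> pendant (snd L1) \<union> X)"
    unfolding X(2) by (rule level_inv_contract_boundary)
  then show ?thesis by blast
qed

definition contracted :: "pyramid \<Rightarrow> nat \<Rightarrow> edge set" where
  "contracted P k = (\<Union>j<k. kernels P j)"

lemma level_inv_pyramid:
  assumes "pyramid_on I P" and "finite (pixels I)" and "k \<le> height P"
  shows "\<exists>C. level_inv (pixels I) (level P k) (contracted P k) C"
  using assms(3)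
proof (induction k)
  case 0
  have "level P 0 = base_level I" using assms(1) by (simp add: pyramid_on_def)
  then show ?case using level_inv_base[of I] by (auto simp: contracted_def)
next
  case (Suc k)
  then obtain C where "level_inv (pixels I) (level P k) (contracted P k) C" by auto
  moreover have "pyramid_step (fg I) (level P k) (kernels P k) (level P (Suc k))"
    using assms(1) Suc(2) by (simp add: pyramid_on_def)
  moreover have "contracted P (Suc k) = contracted P k \<union> kernels P k"
    by (auto simp: contracted_def lessThan_Suc)
  ultimately show ?case using level_inv_step[OF _ assms(2)] by metis
qed

lemma pixel_quotient_level:
  assumes "level_inv D L A C" "finite D"
  shows "pixel_quotient D (grid_edges D) A (fst L)"
  using assms grid_edge_card by unfold_locales (auto simp: level_inv_def)

section \<open>Down-projected cocycles\<close>

text \<open>The last clause is the cocycle condition: the cochain vanishes on the boundary of every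
  foreground face. The middle clause excludes edges inside a receptive field, where counting at
  pixels and counting around faces disagree.\<close>

definition cocycle_at :: "pixel set \<Rightarrow> (pixel, edge) multigraph \<Rightarrow> edge set \<Rightarrow> bool" where
  "cocycle_at F G A \<longleftrightarrow> A \<subseteq> edges G \<and> (\<forall>e\<in>A. \<forall>v\<in>verts G. \<not> e \<subseteq> v) \<and>
     (\<forall>v\<in>verts G. v \<subseteq> F \<longrightarrow> even (incidences A v))"

lemma cocycle_at_down_step:
  assumes P: "pyramid_on I P" and fin: "finite (pixels I)" and k: "k < height P"
    and A: "cocycle_at (fg I) (fst (level P (Suc k))) A"
  shows "cocycle_at (fg I) (fst (level P k)) (down_step (fg I) P k A)"
    and "A \<subseteq> down_step (fg I) P k A"
    and "down_step (fg I) P k A - A \<subseteq> {e \<in> kernels P k. e \<subseteq> fg I}"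
proof -
  define L T R where "L = level P k" "T = kernels P k" "R = survivors P k"
  define G where "G = fst L"
  have step: "pyramid_step (fg I) L T (level P (Suc k))"
    and surv: "surviving_vertices G T R"
    using P k by (simp_all add: pyramid_on_def L_T_R_def G_def)
  obtain C where inv: "level_inv (pixels I) L (contracted P k) C"
    using level_inv_pyramid[OF P fin, of k] k unfolding L_T_R_def by auto
  interpret pixel_quotient "pixels I" "grid_edges (pixels I)" "contracted P k" G
    unfolding G_def using pixel_quotient_level[OF inv fin] .
  have eL: "edges (snd L) = edges G" using inv by (simp add: level_inv_def G_def)
  note next_level = pyramid_step_verts[OF step]
  have adm: "admissible_kernels (fg I) G T" using step by (simp add: pyramid_step_def G_def)
  have AG: "A \<subseteq> edges G - T"
  proof (rule subset_trans)
    show "A \<subseteq> edges (fst (level P (Suc k)))" using A by (simp add: cocycle_at_def)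
    show "edges (fst (level P (Suc k))) \<subseteq> edges G - T" unfolding G_def by (rule next_level(2))
  qed
  then have A1: "A \<subseteq> edges G" "A \<inter> T = {}" by blast+
  define B where "B = {e \<in> T. \<exists>v m. v \<subseteq> fg I \<and> starts G T R e v \<and> has_label L T R A v m \<and> odd m}"
  \<comment> \<open>Every edge of the upper level is also an edge of the lower one, so the
    intersection in \<open>down_step\<close> loses nothing of \<open>A\<close>.\<close>
  have ds: "down_step (fg I) P k A = A \<union> B"
    using A1(1) by (simp add: down_step_def Let_def B_def L_T_R_def[symmetric] eL
        G_def[symmetric] Int_absorb2)
  have A2: "\<not> e \<subseteq> v" if "e \<in> A" "v \<in> verts (contract T G)" for e v
    using A that next_level(1) unfolding cocycle_at_def G_def by simp
  have A3: "even (incidences A v)" if "v \<in> verts (contract T G)" "v \<subseteq> fg I" for v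
    using A that next_level(1) unfolding cocycle_at_def G_def by simp
  note down = down_level[OF G_def eL adm surv A1 A2 A3 B_def]
  have BT: "B \<subseteq> T" unfolding B_def by blast
  have "T \<subseteq> edges G" using adm by (simp add: admissible_kernels_def forest_def)
  then have "A \<union> B \<subseteq> edges G" using A1(1) BT by blast
  then show "cocycle_at (fg I) (fst (level P k)) (down_step (fg I) P k A)"
    unfolding cocycle_at_def ds L_T_R_def(1)[symmetric] G_def[symmetric] using down(1,2) by blast
  show "A \<subseteq> down_step (fg I) P k A" unfolding ds by blast
  show "down_step (fg I) P k A - A \<subseteq> {e \<in> kernels P k. e \<subseteq> fg I}"
    unfolding ds L_T_R_def(2)[symmetric] using down(3) BT by blast
qed

lemma cocycle_at_project_down:
  assumes P: "pyramid_on I P" and fin: "finite (pixels I)" and "k \<le> height P"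
    and "cocycle_at (fg I) (fst (level P k)) A"
  shows "cocycle_at (fg I) (fst (level P 0)) (project_down (fg I) P k A) \<and>
    A \<subseteq> project_down (fg I) P k A \<and>
    project_down (fg I) P k A - A \<subseteq> {e \<in> contracted P k. e \<subseteq> fg I}"
  using assms(3,4)
proof (induction k arbitrary: A)
  case 0
  then show ?case by simp
next
  case (Suc k)
  have k: "k < height P" "k \<le> height P" using Suc(2) by simp_all
  note step = cocycle_at_down_step[OF P fin k(1) Suc.prems(2)]
  note IH = Suc.IH[OF k(2) step(1)]
  have "contracted P (Suc k) = contracted P k \<union> kernels P k"
    by (auto simp: contracted_def lessThan_Suc)
  then have sub: "{e \<in> kernels P k. e \<subseteq> fg I} \<subseteq> {e \<in> contracted P (Suc k). e \<subseteq> fg I}"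
    "{e \<in> contracted P k. e \<subseteq> fg I} \<subseteq> {e \<in> contracted P (Suc k). e \<subseteq> fg I}" by blast+
  define Y where "Y = down_step (fg I) P k A"
  define Z where "Z = project_down (fg I) P k Y"
  have Z: "cocycle_at (fg I) (fst (level P 0)) Z" "Y \<subseteq> Z"
    "Z - Y \<subseteq> {e \<in> contracted P k. e \<subseteq> fg I}"
    using IH unfolding Y_def[symmetric] Z_def[symmetric] by simp_all
  have "A \<subseteq> Z" using step(2) Z(2) unfolding Y_def by (rule subset_trans)
  moreover have "Z - A \<subseteq> (Z - Y) \<union> (Y - A)" by blast
  then have "Z - A \<subseteq> {e \<in> contracted P (Suc k). e \<subseteq> fg I}"
    using Z(3) step(3)[folded Y_def] sub by (meson Un_least order_trans)
  ultimately show ?case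
    using Z(1) unfolding project_down.simps Y_def[symmetric] Z_def[symmetric] by simp
qed

section \<open>Even edge sets of the grid are boundaries\<close>

definition hor :: "int \<Rightarrow> int \<Rightarrow> edge" where
  "hor x y = {(x, y), (x + 1, y)}"

definition ver :: "int \<Rightarrow> int \<Rightarrow> edge" where
  "ver x y = {(x, y), (x, y + 1)}"

lemma hor_eq_iff [simp]: "hor x y = hor x' y' \<longleftrightarrow> x = x' \<and> y = y'"
  by (auto simp: hor_def doubleton_eq_iff)

lemma ver_eq_iff [simp]: "ver x y = ver x' y' \<longleftrightarrow> x = x' \<and> y = y'"
  by (auto simp: ver_def doubleton_eq_iff)

lemma hor_neq_ver [simp]: "hor x y \<noteq> ver x' y'" "ver x' y' \<noteq> hor x y"
  by (auto simp: hor_def ver_def doubleton_eq_iff)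

lemma grid_edge_cases:
  assumes "e \<in> grid_edges D"
  obtains x y where "e = hor x y" "(x, y) \<in> D" "(x + 1, y) \<in> D"
  | x y where "e = ver x y" "(x, y) \<in> D" "(x, y + 1) \<in> D"
proof -
  obtain p q where e: "e = {p, q}" "adj4 p q" "p \<in> D" "q \<in> D"
    using assms by (auto simp: grid_edges_def)
  then have "e \<subseteq> D" by blast
  from adj4_cases[OF e(2)] show thesis
  proof cases
    case (1 x y)
    then show thesis using that(1)[of x y] \<open>e \<subseteq> D\<close> unfolding hor_def e(1) by simp
  next
    case (2 x y)
    then show thesis using that(2)[of x y] \<open>e \<subseteq> D\<close> unfolding ver_def e(1) by simp
  qed
qed

text \<open>The edges of \<open>C\<close> crossed by the leftward ray from the centre
  \<open>(x + 1/2, y + 1/2)\<close> of the block \<open>(x, y)\<close>. The parity of their number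
  is the inside-outside test of the Jordan curve theorem.\<close>

definition ray :: "edge set \<Rightarrow> int \<Rightarrow> int \<Rightarrow> edge set" where
  "ray C x y = {e \<in> C. \<exists>i\<le>x. e = ver i y}"

lemma finite_ray: "finite C \<Longrightarrow> finite (ray C x y)"
  by (simp add: ray_def)

lemma ray_step:
  assumes "finite C"
  shows "ver x y \<in> C \<longleftrightarrow> odd (card (ray C x y)) \<noteq> odd (card (ray C (x - 1) y))"
proof -
  have eq: "ray C x y = (if ver x y \<in> C then {ver x y} else {}) \<union> ray C (x - 1) y"
  proof -
    have "i \<le> x \<longleftrightarrow> i = x \<or> i \<le> x - 1" for i by linarith
    then show ?thesis unfolding ray_def by auto
  qed
  have "ver x y \<notin> ray C (x - 1) y" by (auto simp: ray_def)
  then show ?thesis unfolding eq using finite_ray[OF assms, of "x - 1" y] by simp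
qed

lemma odd_edges_even:
  assumes C: "even_edges (\<lambda>e. e) C" and "finite W"
  shows "even (card {e \<in> C. odd (card (e \<inter> W))})"
proof -
  have "finite C" using C by (simp add: even_edges_def)
  then show ?thesis using even_edges_cut[OF assms] even_sum_iff[of C "\<lambda>e. card (e \<inter> W)"] by simp
qed

text \<open>The pixels between the two rays form a row segment ending at \<open>x\<close>. The edges
  of \<open>C\<close> that leave it are those crossed by one of the rays and possibly
  \<open>hor x y\<close>, and a cycle modulo 2 crosses this cut evenly often.\<close>

lemma ray_cross:
  assumes D: "D = {a..b} \<times> {c..d}" and C: "C \<subseteq> grid_edges D" "even_edges (\<lambda>e. e) C"
  shows "hor x y \<in> C \<longleftrightarrow> odd (card (ray C x y)) \<noteq> odd (card (ray C x (y - 1)))"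
proof -
  have finC: "finite C" using C(2) by (simp add: even_edges_def)
  define W where "W = {a..x} \<times> {y}"
  have odd: "odd (card (e \<inter> W)) \<longleftrightarrow> e = hor x y \<or> (\<exists>i\<le>x. e = ver i y) \<or> (\<exists>i\<le>x. e = ver i (y - 1))"
    if "e \<in> C" for e
  proof -
    have "e \<in> grid_edges D" using that C(1) by blast
    then show ?thesis
    proof (cases rule: grid_edge_cases)
      case (1 i j)
      have "a \<le> i" using 1 D by simp
      then have "e \<inter> W = (if j = y then if i + 1 \<le> x then {(i, j), (i + 1, j)}
          else if i \<le> x then {(i, j)} else {} else {})"
        unfolding 1(1) hor_def W_def by auto
      then show ?thesis unfolding 1(1) by auto
    next
      case (2 i j)
      have "a \<le> i" using 2 D by simp
      then have "e \<inter> W = (if i \<le> x \<and> j = y then {(i, j)} else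
          if i \<le> x \<and> j + 1 = y then {(i, j + 1)} else {})"
        unfolding 2(1) ver_def W_def by auto
      then show ?thesis unfolding 2(1) by auto
    qed
  qed
  define U where "U = ray C x y \<union> ray C x (y - 1)"
  have "{e \<in> C. odd (card (e \<inter> W))} = (if hor x y \<in> C then {hor x y} else {}) \<union> U"
    unfolding U_def ray_def using odd by auto
  then have *: "even (card ((if hor x y \<in> C then {hor x y} else {}) \<union> U))"
    using odd_edges_even[OF C(2), of W] by (simp add: W_def)
  have U: "finite U" "hor x y \<notin> U"
    using finite_ray[OF finC] by (auto simp: U_def ray_def)
  have "card U = card (ray C x y) + card (ray C x (y - 1))"
    unfolding U_def using finite_ray[OF finC] by (intro card_Un_disjoint) (auto simp: ray_def)
  moreover have "hor x y \<in> C \<longleftrightarrow> odd (card U)"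
    using * U by (cases "hor x y \<in> C") simp_all
  ultimately show ?thesis by simp
qed

text \<open>All blocks that belong to the unbounded face must get the same value. Their rays either
  meet no edge or traverse the full width of the rectangle, and then the crossed edges form a
  cut.\<close>

lemma ray_outside:
  assumes D: "D = {a..b} \<times> {c..d}" and C: "C \<subseteq> grid_edges D" "even_edges (\<lambda>e. e) C"
    and out: "\<not> block (x, y) \<subseteq> D"
  shows "even (card (ray C x y))"
proof -
  have ver: "a \<le> i \<and> i \<le> b \<and> c \<le> j \<and> j + 1 \<le> d" if "ver i j \<in> C" for i j
  proof -
    have "ver i j \<in> grid_edges D" using that C(1) by blast
    then show ?thesis by (cases rule: grid_edge_cases) (auto simp: D)
  qed
  consider "x < a" | "\<not> (c \<le> y \<and> y + 1 \<le> d)" | "b \<le> x" "c \<le> y" "y + 1 \<le> d"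
  proof -
    have "x < a \<or> \<not> (c \<le> y \<and> y + 1 \<le> d) \<or> b < x + 1"
      using out unfolding D block_def by auto
    then show thesis using that by linarith
  qed
  then show ?thesis
  proof cases
    case 1
    then have "ray C x y = {}" unfolding ray_def using ver by fastforce
    then show ?thesis by simp
  next
    case 2
    then have "ray C x y = {}" unfolding ray_def using ver by blast
    then show ?thesis by simp
  next
    case 3
    \<comment> \<open>The pixels below the ray. As the ray spans the whole width, it crosses exactly
      the edges of \<open>C\<close> that leave this set.\<close>
    define W where "W = {a..b} \<times> {c..y}"
    have odd: "odd (card (e \<inter> W)) \<longleftrightarrow> (\<exists>i\<le>x. e = ver i y)" if "e \<in> C" for e
    proof -
      have "e \<in> grid_edges D" using that C(1) by blast
      then show ?thesis
      proof (cases rule: grid_edge_cases)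
        case (1 i j)
        then have "e \<inter> W = (if j \<le> y then {(i, j), (i + 1, j)} else {})"
          unfolding 1(1) hor_def W_def D by auto
        then show ?thesis unfolding 1(1) by auto
      next
        case (2 i j)
        then have "e \<inter> W = (if j + 1 \<le> y then {(i, j), (i, j + 1)} else if j \<le> y then {(i, j)} else {})"
          unfolding 2(1) ver_def W_def D by auto
        then show ?thesis unfolding 2(1) using 2(2) 3(1) D by auto
      qed
    qed
    have "{e \<in> C. odd (card (e \<inter> W))} = ray C x y" unfolding ray_def using odd by blast
    then show ?thesis using odd_edges_even[OF C(2), of W] by (simp add: W_def)
  qed
qed

text \<open>\<open>g\<close> is the colouring of the faces by inside and outside; the colour changes
  exactly across the cycle.\<close>

lemma even_edges_bound_faces:
  assumes D: "D = {a..b} \<times> {c..d}" and C: "C \<subseteq> grid_edges D" "even_edges (\<lambda>e. e) C"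
  shows "\<exists>g :: pixel option \<Rightarrow> bool. \<forall>e\<in>grid_edges D. \<forall>u v. dual_ends D e = {u, v} \<longrightarrow> (e \<in> C \<longleftrightarrow> g u \<noteq> g v)"
proof -
  define h where "h b = odd (card (ray C (fst b) (snd b)))" for b
  \<comment> \<open>By \<open>ray_outside\<close>, the value \<open>False\<close> at the unbounded
    face agrees with the ray parity of every block not contained in \<open>D\<close>.\<close>
  define g where "g u = (case u of None \<Rightarrow> False | Some b \<Rightarrow> h b)" for u
  have g: "g (face_of D b) = h b" for b
    using ray_outside[OF assms, of "fst b" "snd b"] by (auto simp: g_def h_def face_of_def)
  have finC: "finite C" using C(2) by (simp add: even_edges_def)
  have key: "e \<in> C \<longleftrightarrow> g u \<noteq> g v" if e: "e \<in> grid_edges D" "dual_ends D e = {u, v}" for e u v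
    using e(1)
  proof (cases rule: grid_edge_cases)
    case (1 x y)
    have "{u, v} = {face_of D (x, y), face_of D (x, y - 1)}"
      using e(2) dual_ends_horizontal[of D x y] unfolding 1(1) hor_def by simp
    then have "g u \<noteq> g v \<longleftrightarrow> h (x, y) \<noteq> h (x, y - 1)"
      unfolding doubleton_eq_iff using g by metis
    then show ?thesis unfolding 1(1) ray_cross[OF assms] h_def by simp
  next
    case (2 x y)
    have "{u, v} = {face_of D (x, y), face_of D (x - 1, y)}"
      using e(2) dual_ends_vertical[of D x y] unfolding 2(1) ver_def by simp
    then have "g u \<noteq> g v \<longleftrightarrow> h (x, y) \<noteq> h (x - 1, y)"
      unfolding doubleton_eq_iff using g by metis
    then show ?thesis unfolding 2(1) ray_step[OF finC] h_def by simp
  qed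
  show ?thesis by (intro exI[of _ g] ballI allI impI key)
qed

text \<open>The colour is constant along dual edges that are not in \<open>C\<close>; if these
  connect all faces, no edge separates two colours.\<close>

lemma even_edges_avoiding_connected_dual:
  assumes D: "D = {a..b} \<times> {c..d}" and C: "C \<subseteq> grid_edges D" "even_edges (\<lambda>e. e) C"
    and X: "X \<subseteq> grid_edges D" "X \<inter> C = {}"
    and conn: "\<And>u v. u \<in> range (face_of D) \<Longrightarrow> v \<in> range (face_of D) \<Longrightarrow>
      (u, v) \<in> reach (dual_ends D) X"
  shows "C = {}"
proof -
  obtain g :: "pixel option \<Rightarrow> bool" where
    "\<forall>e\<in>grid_edges D. \<forall>u v. dual_ends D e = {u, v} \<longrightarrow> (e \<in> C \<longleftrightarrow> g u \<noteq> g v)"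
    using even_edges_bound_faces[OF D C] ..
  then have g: "e \<in> C \<longleftrightarrow> g u \<noteq> g v" if "e \<in> grid_edges D" "dual_ends D e = {u, v}" for e u v
    using that by metis
  have const: "g u = g v" if "(u, v) \<in> reach (dual_ends D) X" for u v
    using that
  proof (induction rule: reach_induct)
    case refl
    show ?case ..
  next
    case (step v w e)
    then have "e \<in> grid_edges D" "e \<notin> C" using X by blast+
    then show ?case using g[OF _ step(3)] step(4) by blast
  qed
  have "e \<notin> C" for e
  proof
    assume eC: "e \<in> C"
    then have eD: "e \<in> grid_edges D" using C(1) by blast
    then obtain u v where "u \<in> range (face_of D)" "v \<in> range (face_of D)" "dual_ends D e = {u, v}"
      "ends (boundary_graph D) e = {parts (dual_ends D) {} u, parts (dual_ends D) {} v}"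
      by (rule quotient_ends[OF quotient_boundary_graph])
    then have "g u = g v" by (intro const conn)
    then show False using g[OF eD \<open>dual_ends D e = {u, v}\<close>] eC by simp
  qed
  then show ?thesis by blast
qed

lemma degree_singleton:
  assumes "e = {p, q}" "p \<noteq> q"
  shows "odd (card {g \<in> {e}. v \<in> g}) \<longleftrightarrow> (v = p) \<noteq> (v = q)"
proof -
  have "{g \<in> {e}. v \<in> g} = (if v = p \<or> v = q then {e} else {})" using assms by auto
  then show ?thesis using assms(2) by auto
qed

section \<open>Self-loops of the generator level\<close>

text \<open>Two distinct edges of this kind, together with kernel paths inside both receptive
  fields, would form a nonempty cycle modulo 2, while the boundary edges in
  \<open>C \<union> S\<close> connect all faces of the grid without crossing it.\<close>

lemma parallel_edges_eq:
  assumes D: "D = {a..b} \<times> {c..d}" and L: "level_inv D L A C" and S: "spanning_tree (snd L) S"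
    and e: "e \<in> edges (fst L) - S" "e = {p, q}" and e': "e' \<in> edges (fst L) - S" "e' = {p', q'}"
    and par: "(p, p') \<in> reach (\<lambda>e. e) A" "(q, q') \<in> reach (\<lambda>e. e) A"
  shows "e = e'"
proof (rule ccontr)
  assume neq: "e \<noteq> e'"
  have Q: "quotient (\<lambda>e. e) D (grid_edges D) A (fst L)"
    and Q': "quotient (dual_ends D) (range (face_of D)) (grid_edges D) C (snd L)"
    and eL: "edges (snd L) = edges (fst L)" and AC: "A \<inter> C = {}" "edges (fst L) \<inter> (A \<union> C) = {}"
    using L by (simp_all add: level_inv_def)
  have AD: "A \<subseteq> grid_edges D" using quotient_contracted[OF Q] .
  have CD: "C \<subseteq> grid_edges D" using quotient_contracted[OF Q'] .
  have LD: "edges (fst L) \<subseteq> grid_edges D" using quotient_edges[OF Q] .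
  have SL: "S \<subseteq> edges (fst L)" using S eL by (simp add: spanning_tree_def forest_def)
  have card2: "card g = 2" if "g \<in> A" for g using that AD grid_edge_card by blast
  have ee: "e \<in> grid_edges D" "e' \<in> grid_edges D" using e(1) e'(1) LD by blast+
  have "card e = 2" "card e' = 2" using ee grid_edge_card by blast+
  then have pq: "p \<noteq> q" "p' \<noteq> q'" using e(2) e'(2) by auto
  obtain B where B: "B \<subseteq> A" "finite B" "\<And>v. odd (card {g \<in> B. v \<in> g}) \<longleftrightarrow> (v = p) \<noteq> (v = p')"
    using reach_join[OF par(1) card2] by blast
  obtain B' where B': "B' \<subseteq> A" "finite B'" "\<And>v. odd (card {g \<in> B'. v \<in> g}) \<longleftrightarrow> (v = q) \<noteq> (v = q')"
    using reach_join[OF par(2) card2] by blast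
  \<comment> \<open>A closed walk: \<open>e\<close> from \<open>p\<close> to \<open>q\<close>,
    \<open>B'\<close> on to \<open>q'\<close>, \<open>e'\<close> back to \<open>p'\<close>, and
    \<open>B\<close> to \<open>p\<close>.\<close>
  define Z where "Z = sym_diff (sym_diff {e} {e'}) (sym_diff B B')"
  have "even (card {g \<in> Z. v \<in> g})" for v
  proof -
    have 1: "even (card {g \<in> sym_diff {e} {e'}. v \<in> g}) \<longleftrightarrow>
        ((v = p) \<noteq> (v = q)) = ((v = p') \<noteq> (v = q'))"
    proof -
      have "even (card {g \<in> sym_diff {e} {e'}. v \<in> g}) \<longleftrightarrow>
          (even (card {g \<in> {e}. v \<in> g}) \<longleftrightarrow> even (card {g \<in> {e'}. v \<in> g}))"
        by (rule degree_sym_diff_parity[of _ _ v "\<lambda>e. e"]) simp_all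
      then show ?thesis
        using degree_singleton[OF e(2) pq(1), of v] degree_singleton[OF e'(2) pq(2), of v] by argo
    qed
    have 2: "even (card {g \<in> sym_diff B B'. v \<in> g}) \<longleftrightarrow>
        ((v = p) \<noteq> (v = p')) = ((v = q) \<noteq> (v = q'))"
    proof -
      have "even (card {g \<in> sym_diff B B'. v \<in> g}) \<longleftrightarrow>
          (even (card {g \<in> B. v \<in> g}) \<longleftrightarrow> even (card {g \<in> B'. v \<in> g}))"
        by (rule degree_sym_diff_parity[of _ _ v "\<lambda>e. e"]) (simp_all add: B(2) B'(2))
      then show ?thesis using B(3)[of v] B'(3)[of v] by argo
    qed
    have "even (card {g \<in> Z. v \<in> g}) \<longleftrightarrow>
        (even (card {g \<in> sym_diff {e} {e'}. v \<in> g}) \<longleftrightarrow> even (card {g \<in> sym_diff B B'. v \<in> g}))"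
      unfolding Z_def
      by (rule degree_sym_diff_parity[of _ _ v "\<lambda>e. e"]) (simp_all add: B(2) B'(2))
    then show ?thesis unfolding 1 2 by argo
  qed
  moreover have "finite Z" using B(2) B'(2) by (simp add: Z_def)
  ultimately have even: "even_edges (\<lambda>e. e) Z" by (simp add: even_edges_def)
  have Zsub: "Z \<subseteq> {e, e'} \<union> A" using B(1) B'(1) unfolding Z_def by blast
  have "Z = {}"
  proof (rule even_edges_avoiding_connected_dual[OF D _ even])
    show "Z \<subseteq> grid_edges D" using Zsub AD ee by blast
    show "C \<union> S \<subseteq> grid_edges D" using CD SL LD by blast
    show "(C \<union> S) \<inter> Z = {}" using Zsub AC SL e(1) e'(1) by blast
    fix u v assume u: "u \<in> range (face_of D)" and v: "v \<in> range (face_of D)"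
    have verts: "parts (dual_ends D) C u \<in> verts (snd L)" "parts (dual_ends D) C v \<in> verts (snd L)"
      unfolding quotient_verts[OF Q'] using u v by blast+
    \<comment> \<open>\<open>S\<close> spans the contracted top graph; lifting its walks to the base
      grid fills them in with edges of \<open>C\<close>.\<close>
    have "(parts (dual_ends D) C u, parts (dual_ends D) C v) \<in> reach (ends (snd L)) S"
      using S verts unfolding spanning_tree_def link_rtrancl by blast
    moreover have "S \<subseteq> grid_edges D" using SL LD by blast
    ultimately obtain w where w: "parts (dual_ends D) C v = parts (dual_ends D) C w"
        "(u, w) \<in> reach (dual_ends D) (C \<union> S)"
      using quotient_reach[OF Q' _ u] by blast
    have "(w, v) \<in> reach (dual_ends D) C" using w(1) parts_eq_iff by metis
    then have "(w, v) \<in> reach (dual_ends D) (C \<union> S)" by (rule reach_mono[rotated]) blast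
    then show "(u, v) \<in> reach (dual_ends D) (C \<union> S)" using w(2) by (rule reach_trans[rotated])
  qed
  \<comment> \<open>\<open>e\<close> is still an edge at this level, so it is not in
    \<open>A\<close> and nothing cancels it.\<close>
  moreover have "e \<in> Z" using neq e(1) AC B(1) B'(1) unfolding Z_def by blast
  ultimately show False by blast
qed

lemma face_boundary_generator_level:
  assumes "edges (snd L) = edges (fst L)"
  shows "face_boundary (contract_boundary S L) f = {e \<in> edges (fst L) - S. f \<in> ends (fst L) e}"
  using assms by (auto simp: face_boundary_def contract_boundary_def contract_def remove_def)

lemma verts_contract_boundary: "verts (fst (contract_boundary S L)) = verts (fst L)"
  and ends_contract_boundary: "ends (fst (contract_boundary S L)) = ends (fst L)"
  by (simp_all add: contract_boundary_def remove_def)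

lemma (in pixel_quotient) edge_ends_distinct_verts:
  assumes "e \<in> E" "ends G e = {f, R}" "f \<noteq> R"
  obtains p q where "e = {p, q}" "p \<in> f" "q \<in> R" "f \<in> verts G" "R \<in> verts G"
proof -
  obtain p q where pq: "p \<in> D" "q \<in> D" "p \<noteq> q" "e = {p, q}" "ends G e = {part p, part q}"
    using assms(1) by (rule edge_ends)
  have "{part p, part q} = {f, R}" using assms(2) pq(5) by simp
  then consider "f = part p" "R = part q" | "f = part q" "R = part p"
    unfolding doubleton_eq_iff by blast
  then show thesis
  proof cases
    case 1
    show thesis
      by (rule that[OF pq(4)]) (use pq(1,2) in \<open>simp_all add: 1 part_vert\<close>)
  next
    case 2
    show thesis
      by (rule that[of q p])
        (use pq(1,2) in \<open>simp_all add: 2 part_vert pq(4) insert_commute\<close>)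
  qed
qed

lemma (in pixel_quotient) vert_nonempty:
  assumes "v \<in> verts G"
  shows "v \<noteq> {}"
proof -
  obtain p where "v = part p" using assms quotient_verts[OF quotient] by blast
  then have "p \<in> v" by simp
  then show ?thesis by blast
qed

section \<open>The top-level cocycle and its projection onto the contraction kernel\<close>

text \<open>Each loop has one pixel in \<open>f\<close>, which gives 2 there and 0 at every other
  foreground face. The different background sides keep the loops distinct, so they do not collapse
  to one edge.\<close>

lemma cocycle_at_pair:
  assumes Q: "pixel_quotient D E S G" and E: "\<alpha> \<in> edges G" "\<beta> \<in> edges G"
    and \<alpha>: "ends G \<alpha> = {f, H}" and \<beta>: "ends G \<beta> = {f, U}"
    and F: "f \<subseteq> F" "H \<inter> F = {}" "U \<inter> F = {}" "H \<noteq> U" "f \<noteq> {}"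
  shows "cocycle_at F G {\<alpha>, \<beta>}"
proof -
  interpret pixel_quotient D E S G by (rule Q)
  have neq: "\<alpha> \<noteq> \<beta>" using \<alpha> \<beta> F(4) by (auto simp: doubleton_eq_iff)
  have edge: "(\<forall>v\<in>verts G. \<not> e \<subseteq> v) \<and> (\<forall>v\<in>verts G. v \<subseteq> F \<longrightarrow> card (e \<inter> v) = of_bool (v = f))"
    if e: "e \<in> edges G" "ends G e = {f, R}" and R: "R \<inter> F = {}" for e R
  proof -
    have "e \<in> E" using e(1) quotient_edges[OF quotient] by blast
    moreover have fR: "f \<noteq> R" using R F(1,5) by blast
    ultimately obtain p q where pq: "e = {p, q}" "p \<in> f" "q \<in> R" "f \<in> verts G" "R \<in> verts G"
      using e(2) by (metis edge_ends_distinct_verts)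
    have eq: "p \<in> v \<longleftrightarrow> v = f" "q \<in> v \<longleftrightarrow> v = R" if "v \<in> verts G" for v
      using vert_disjoint that pq(2-5) by blast+
    have "card (e \<inter> v) = of_bool (v = f)" if "v \<in> verts G" "v \<subseteq> F" for v
    proof -
      have "q \<notin> v" using that(2) R pq(3) by blast
      then have "e \<inter> v = (if v = f then {p} else {})" using eq(1)[OF that(1)] unfolding pq(1) by auto
      then show ?thesis by simp
    qed
    moreover have "\<not> e \<subseteq> v" if "v \<in> verts G" for v
      using eq[OF that] fR unfolding pq(1) by blast
    ultimately show ?thesis by blast
  qed
  note e\<alpha> = edge[OF E(1) \<alpha> F(2)] and e\<beta> = edge[OF E(2) \<beta> F(3)]
  have "incidences {\<alpha>, \<beta>} v = card (\<alpha> \<inter> v) + card (\<beta> \<inter> v)" for v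
    unfolding incidences_def using neq by simp
  then have "even (incidences {\<alpha>, \<beta>} v)" if "v \<in> verts G" "v \<subseteq> F" for v
    using e\<alpha> e\<beta> that by simp
  moreover have "\<forall>e\<in>{\<alpha>, \<beta>}. \<forall>v\<in>verts G. \<not> e \<subseteq> v"
    using conjunct1[OF e\<alpha>] conjunct1[OF e\<beta>] by simp
  ultimately show ?thesis unfolding cocycle_at_def using E by simp
qed

text \<open>Down projection by itself only places the new edges in kernels within the foreground.
  That they lie in \<open>f\<close> follows from parity: the stray edges have even degree at every
  pixel and belong to a forest, so there are none. This avoids identifying \<open>f\<close> with the
  whole foreground.\<close>

lemma down_projected_cocycle_on_eck:
  assumes P: "pyramid_on I P" and fin: "finite (pixels I)"
    and f: "f \<in> object_faces I (generator_level P S)"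
    and \<alpha>: "loop_between (generator_level P S) f H \<alpha>"
    and \<beta>: "loop_between (generator_level P S) f U \<beta>"
    and HU: "H \<inter> fg I = {}" "U \<inter> fg I = {}" "H \<noteq> U"
  defines "Z \<equiv> down_projected_cocycle I P \<alpha> \<beta>"
  shows "finite Z" "{\<alpha>, \<beta>} \<subseteq> Z" "Z - {\<alpha>, \<beta>} \<subseteq> snd (eck P f)"
    "\<And>p. p \<in> fg I \<Longrightarrow> p \<in> pixels I \<Longrightarrow> even (card {e \<in> Z. p \<in> e})"
proof -
  define n where "n = height P"
  define L where "L = level P n"
  define G where "G = fst L"
  define D where "D = pixels I"
  define K where "K = contracted P n"
  obtain C where inv: "level_inv D L K C"
    using level_inv_pyramid[OF P fin, of n] unfolding n_def L_def D_def K_def by auto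
  have finD: "finite D" using fin by (simp add: D_def)
  interpret pixel_quotient D "grid_edges D" K G
    unfolding G_def using pixel_quotient_level[OF inv finD] .
  have eL: "edges (snd L) = edges (fst L)" and free: "even_free (\<lambda>e. e) K"
    using inv by (simp_all add: level_inv_def)
  have gl: "generator_level P S = contract_boundary S L"
    by (simp add: generator_level_def L_def n_def)
  have fv: "f \<in> verts G" "f \<subseteq> fg I"
    using f unfolding gl object_faces_def verts_contract_boundary G_def by blast+
  have "f \<noteq> {}" using vert_nonempty[OF fv(1)] .
  have loops: "\<alpha> \<in> edges G" "\<beta> \<in> edges G" "ends G \<alpha> = {f, H}" "ends G \<beta> = {f, U}"
    using \<alpha> \<beta> unfolding loop_between_def gl face_boundary_generator_level[OF eL]
      ends_contract_boundary G_def by blast+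
  have "cocycle_at (fg I) (fst (level P n)) {\<alpha>, \<beta>}"
    using cocycle_at_pair[OF pixel_quotient_axioms loops fv(2) HU \<open>f \<noteq> {}\<close>]
    unfolding G_def L_def .
  moreover have "Z = project_down (fg I) P n {\<alpha>, \<beta>}"
    by (simp add: Z_def down_projected_cocycle_def n_def)
  ultimately have Z: "cocycle_at (fg I) (fst (level P 0)) Z" "{\<alpha>, \<beta>} \<subseteq> Z"
    "Z - {\<alpha>, \<beta>} \<subseteq> {e \<in> K. e \<subseteq> fg I}"
    using cocycle_at_project_down[OF P fin, of n "{\<alpha>, \<beta>}"] unfolding K_def n_def by simp_all
  have base: "level P 0 = base_level I" using P by (simp add: pyramid_on_def)
  have "Z \<subseteq> edges (adjacency_graph D)"
    using Z(1) unfolding cocycle_at_def base base_level_def D_def fst_conv by (rule conjunct1)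
  then have Zsub: "Z \<subseteq> grid_edges D"
    using quotient_edges[OF quotient_adjacency_graph] by (rule subset_trans)
  then show finZ: "finite Z" using finite_E by (rule finite_subset)
  show "{\<alpha>, \<beta>} \<subseteq> Z" by (rule Z(2))
  have inc: "incidences X {p} = card {e \<in> X. p \<in> e}" if "finite X" for X p
  proof -
    have "card (e \<inter> {p}) = of_bool (p \<in> e)" for e :: edge by simp
    then show ?thesis unfolding incidences_def using that by (simp add: Int_def)
  qed
  show even: "even (card {e \<in> Z. p \<in> e})" if "p \<in> fg I" "p \<in> pixels I" for p
  proof -
    have "{p} \<in> verts (fst (level P 0))"
      using that(2) by (simp add: base base_level_def adjacency_graph_def)
    then have "even (incidences Z {p})" using Z(1) that(1) unfolding cocycle_at_def by blast
    then show ?thesis using inc[OF finZ] by simp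
  qed
  \<comment> \<open>A contracted edge lies within a single receptive field.\<close>
  have Kpart: "e \<subseteq> f" if e: "e \<in> K" "p \<in> e" "p \<in> f" for e p
  proof -
    have "e \<in> grid_edges D" using e(1) quotient_contracted[OF quotient] by blast
    then obtain x y where xy: "x \<in> D" "y \<in> D" "x \<noteq> y" "e = {x, y}" "ends G e = {part x, part y}"
      by (rule edge_ends)
    have "part x = part y" unfolding parts_eq_iff by (rule reach_edge[of e K "\<lambda>e. e", OF e(1) xy(4)])
    then show ?thesis using vert_iff_mem[OF fv(1)] e(2,3) unfolding xy(4) by auto
  qed
  have out: "p \<notin> \<alpha> \<and> p \<notin> \<beta>" if "p \<in> fg I" "p \<notin> f" for p
  proof -
    have "p \<notin> e" if e: "e \<in> edges G" "ends G e = {f, R}" "R \<inter> fg I = {}" for e R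
    proof -
      have "e \<in> grid_edges D" using e(1) quotient_edges[OF quotient] by blast
      moreover have "f \<noteq> R" using e(3) fv(2) \<open>f \<noteq> {}\<close> by blast
      ultimately obtain x y where "e = {x, y}" "x \<in> f" "y \<in> R" "f \<in> verts G" "R \<in> verts G"
        using e(2) by (metis edge_ends_distinct_verts)
      then show ?thesis using \<open>p \<in> fg I\<close> \<open>p \<notin> f\<close> e(3) by blast
    qed
    then show ?thesis using loops HU by blast
  qed
  \<comment> \<open>The stray edges. At a foreground pixel outside \<open>f\<close> they are all the
    edges of \<open>Z\<close>, whose number is even; at any other pixel there are none.\<close>
  define X where "X = {e \<in> Z - {\<alpha>, \<beta>}. \<not> e \<subseteq> f}"
  have XK: "X \<subseteq> K" "\<And>e. e \<in> X \<Longrightarrow> e \<subseteq> fg I" using Z(3) unfolding X_def by blast+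
  have "even (card {e \<in> X. p \<in> e})" for p
  proof (cases "p \<in> fg I \<and> p \<notin> f")
    case True
    have "{e \<in> X. p \<in> e} = {e \<in> Z. p \<in> e}" using out True unfolding X_def by blast
    moreover have "even (card {e \<in> Z. p \<in> e})"
    proof (cases "p \<in> pixels I")
      case True
      then show ?thesis using even \<open>p \<in> fg I \<and> p \<notin> f\<close> by blast
    next
      case False
      have "p \<notin> e" if "e \<in> Z" for e
      proof -
        have "e \<in> grid_edges D" using that Zsub by blast
        then obtain x y where "x \<in> D" "y \<in> D" "x \<noteq> y" "e = {x, y}" "ends G e = {part x, part y}"
          by (rule edge_ends)
        then show ?thesis using False unfolding D_def by blast
      qed
      then have "{e \<in> Z. p \<in> e} = {}" by blast
      then show ?thesis by (simp only: card.empty even_zero)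
    qed
    ultimately show ?thesis by simp
  next
    case False
    have "p \<notin> e" if "e \<in> X" for e
      using False Kpart[of e p] that XK unfolding X_def by blast
    then have "{e \<in> X. p \<in> e} = {}" by blast
    then show ?thesis by (simp only: card.empty even_zero)
  qed
  moreover have "finite X" using finZ by (simp add: X_def)
  ultimately have "even_edges (\<lambda>e. e) X" by (simp add: even_edges_def)
  then have "X = {}" using free XK(1) unfolding even_free_def by blast
  then have sub: "e \<subseteq> f" if "e \<in> Z - {\<alpha>, \<beta>}" for e using that unfolding X_def by blast
  have eck: "snd (eck P f) = {e \<in> K. e \<subseteq> f}" by (simp add: eck_def K_def contracted_def n_def)
  show "Z - {\<alpha>, \<beta>} \<subseteq> snd (eck P f)"
  proof
    fix e assume e: "e \<in> Z - {\<alpha>, \<beta>}"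
    then have "e \<in> K" using subsetD[OF Z(3)] by simp
    then show "e \<in> snd (eck P f)" unfolding eck using sub[OF e] by simp
  qed
qed

lemma loop_between_pixels:
  assumes P: "pyramid_on I P" and fin: "finite (pixels I)"
    and f: "f \<in> object_faces I (generator_level P S)"
    and e: "loop_between (generator_level P S) f R e" and R: "R \<inter> fg I = {}"
  obtains p q where "e = {p, q}" "p \<in> f" "q \<in> R"
proof -
  define L where "L = level P (height P)"
  obtain C where inv: "level_inv (pixels I) L (contracted P (height P)) C"
    using level_inv_pyramid[OF P fin order_refl] unfolding L_def by blast
  interpret pixel_quotient "pixels I" "grid_edges (pixels I)" "contracted P (height P)" "fst L"
    using pixel_quotient_level[OF inv fin] .
  have eL: "edges (snd L) = edges (fst L)" using inv by (simp add: level_inv_def)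
  have gl: "generator_level P S = contract_boundary S L"
    by (simp add: generator_level_def L_def)
  have fv: "f \<in> verts (fst L)" "f \<subseteq> fg I"
    using f unfolding gl object_faces_def verts_contract_boundary by blast+
  have "f \<noteq> R" using vert_nonempty[OF fv(1)] fv(2) R by blast
  moreover have loop: "e \<in> edges (fst L)" "ends (fst L) e = {f, R}"
    using e unfolding loop_between_def gl face_boundary_generator_level[OF eL]
      ends_contract_boundary by blast+
  moreover have "e \<in> grid_edges (pixels I)" using loop(1) quotient_edges[OF quotient] by blast
  ultimately show thesis using that edge_ends_distinct_verts by metis
qed

text \<open>The second edge is described by its pixels, since that is what pulling an edge back
  under the rotation provides. Kernel paths inside \<open>f\<close> and \<open>R\<close> join its
  ends to those of \<alpha>, as \<open>parallel_edges_eq\<close> requires.\<close>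

lemma loop_between_unique:
  assumes P: "pyramid_on I P" and D: "pixels I = {a..b} \<times> {c..d}"
    and S: "spanning_tree (snd (level P (height P))) S"
    and f: "f \<in> object_faces I (generator_level P S)"
    and \<alpha>: "loop_between (generator_level P S) f R \<alpha>" and R: "R \<inter> fg I = {}"
    and e: "e \<in> face_boundary (generator_level P S) f" "e = {p, q}" "p \<in> f" "q \<in> R"
  shows "e = \<alpha>"
proof -
  define L where "L = level P (height P)"
  have fin: "finite (pixels I)" using D by simp
  obtain C where inv: "level_inv (pixels I) L (contracted P (height P)) C"
    using level_inv_pyramid[OF P fin order_refl] unfolding L_def by blast
  interpret pixel_quotient "pixels I" "grid_edges (pixels I)" "contracted P (height P)" "fst L"
    using pixel_quotient_level[OF inv fin] .
  have eL: "edges (snd L) = edges (fst L)" using inv by (simp add: level_inv_def)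
  have gl: "generator_level P S = contract_boundary S L"
    by (simp add: generator_level_def L_def)
  have fv: "f \<in> verts (fst L)" "f \<subseteq> fg I"
    using f unfolding gl object_faces_def verts_contract_boundary by blast+
  have loop: "\<alpha> \<in> edges (fst L) - S" "ends (fst L) \<alpha> = {f, R}"
    using \<alpha> unfolding loop_between_def gl face_boundary_generator_level[OF eL]
      ends_contract_boundary by blast+
  have eS: "e \<in> edges (fst L) - S"
    using e(1) unfolding gl face_boundary_generator_level[OF eL] by blast
  have "\<alpha> \<in> grid_edges (pixels I)" using loop(1) quotient_edges[OF quotient] by blast
  moreover have "f \<noteq> R" using e(3) fv(2) R by blast
  ultimately obtain x y where xy: "\<alpha> = {x, y}" "x \<in> f" "y \<in> R" "f \<in> verts (fst L)" "R \<in> verts (fst L)"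
    using loop(2) by (metis edge_ends_distinct_verts)
  have "part p = part x" "part q = part y"
    using vert_iff_mem[OF fv(1)] vert_iff_mem[OF xy(5)] e(3,4) xy(2,3) by metis+
  then have reach: "(p, x) \<in> reach (\<lambda>e. e) (contracted P (height P))"
    "(q, y) \<in> reach (\<lambda>e. e) (contracted P (height P))" unfolding parts_eq_iff .
  show ?thesis
    using parallel_edges_eq[OF D inv S[folded L_def] eS e(2) loop(1) xy(1) reach] .
qed

section \<open>Rotations of the pixel grid\<close>

lemma imaginary_unit_power:
  "\<exists>s t :: int. \<i> ^ k = Complex (of_int s) (of_int t) \<and> \<bar>s\<bar> + \<bar>t\<bar> = 1"
proof (induction k)
  case 0
  show ?case by (intro exI[of _ 1] exI[of _ 0]) (simp add: complex_eq_iff)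
next
  case (Suc k)
  then obtain s t :: int where "\<i> ^ k = Complex (of_int s) (of_int t)" "\<bar>s\<bar> + \<bar>t\<bar> = 1" by blast
  then show ?case by (intro exI[of _ "- t"] exI[of _ s]) (simp add: complex_eq_iff)
qed

lemma grid_rotation_coordinates:
  assumes "grid_rotation \<rho>"
  obtains s t u v :: int where "\<bar>s\<bar> + \<bar>t\<bar> = 1"
    "\<And>x y. \<rho> (x, y) = (s * x - t * y + u, t * x + s * y + v)"
proof -
  obtain c k where \<rho>: "\<And>p. centre (\<rho> p) = c + \<i> ^ k * (centre p - c)"
    using assms unfolding grid_rotation_def by blast
  obtain s t :: int where st: "\<i> ^ k = Complex (of_int s) (of_int t)" "\<bar>s\<bar> + \<bar>t\<bar> = 1"
    using imaginary_unit_power by blast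
  \<comment> \<open>The translation part is read off at the origin; in the difference of two images
    the centre \<open>c\<close>, which need not be a lattice point, drops out.\<close>
  obtain u v where uv: "\<rho> (0, 0) = (u, v)" by fastforce
  have "\<rho> (x, y) = (s * x - t * y + u, t * x + s * y + v)" for x y
  proof -
    obtain a b where ab: "\<rho> (x, y) = (a, b)" by fastforce
    have "centre (\<rho> (x, y)) - centre (\<rho> (0, 0)) = \<i> ^ k * (centre (x, y) - centre (0, 0))"
      unfolding \<rho> by (simp add: algebra_simps)
    then have "real_of_int (a - u) = real_of_int (s * x - t * y)"
      "real_of_int (b - v) = real_of_int (t * x + s * y)"
      unfolding ab uv st centre_def by (simp_all add: complex_eq_iff algebra_simps)
    then have "a - u = s * x - t * y" "b - v = t * x + s * y" unfolding of_int_eq_iff .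
    then show ?thesis using ab by simp
  qed
  then show thesis using that st(2) by blast
qed

text \<open>The features of a rotation that matter below, in a form that passes to the inverse at
  once.\<close>

definition adjacency_isomorphism :: "(pixel \<Rightarrow> pixel) \<Rightarrow> bool" where
  "adjacency_isomorphism \<rho> \<longleftrightarrow> bij \<rho> \<and> (\<forall>p q. adj4 (\<rho> p) (\<rho> q) \<longleftrightarrow> adj4 p q)"

lemma adjacency_isomorphism_bij: "adjacency_isomorphism \<rho> \<Longrightarrow> bij \<rho>"
  and adjacency_isomorphism_adj4: "adjacency_isomorphism \<rho> \<Longrightarrow> adj4 (\<rho> p) (\<rho> q) \<longleftrightarrow> adj4 p q"
  unfolding adjacency_isomorphism_def by blast+

lemma grid_rotation_adjacency_isomorphism:
  assumes "grid_rotation \<rho>"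
  shows "adjacency_isomorphism \<rho>"
proof -
  obtain s t u v where st: "\<bar>s\<bar> + \<bar>t\<bar> = 1"
    and \<rho>: "\<And>x y. \<rho> (x, y) = (s * x - t * y + u, t * x + s * y + v)"
    using grid_rotation_coordinates[OF assms] by blast
  have "s = 1 \<and> t = 0 \<or> s = - 1 \<and> t = 0 \<or> s = 0 \<and> t = 1 \<or> s = 0 \<and> t = - 1"
    using st by linarith
  \<comment> \<open>The four quarter turns, each followed by a translation.\<close>
  then have cases: "(\<forall>x y. \<rho> (x, y) = (x + u, y + v)) \<or> (\<forall>x y. \<rho> (x, y) = (u - x, v - y)) \<or>
      (\<forall>x y. \<rho> (x, y) = (u - y, x + v)) \<or> (\<forall>x y. \<rho> (x, y) = (y + u, v - x))"
    using \<rho> by auto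
  have "inj \<rho>" unfolding inj_def using cases by (elim disjE) auto
  moreover have "surj \<rho>"
    unfolding surj_def
  proof
    fix p :: pixel
    obtain a b where p: "p = (a, b)" by fastforce
    show "\<exists>q. p = \<rho> q"
      using cases
    proof (elim disjE)
      assume "\<forall>x y. \<rho> (x, y) = (x + u, y + v)"
      then show ?thesis using p by (intro exI[of _ "(a - u, b - v)"]) simp
    next
      assume "\<forall>x y. \<rho> (x, y) = (u - x, v - y)"
      then show ?thesis using p by (intro exI[of _ "(u - a, v - b)"]) simp
    next
      assume "\<forall>x y. \<rho> (x, y) = (u - y, x + v)"
      then show ?thesis using p by (intro exI[of _ "(b - v, u - a)"]) simp
    next
      assume "\<forall>x y. \<rho> (x, y) = (y + u, v - x)"
      then show ?thesis using p by (intro exI[of _ "(v - b, a - u)"]) simp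
    qed
  qed
  moreover have "adj4 (\<rho> p) (\<rho> q) \<longleftrightarrow> adj4 p q" for p q
    using cases by (cases p; cases q) (elim disjE; simp add: adj4_def abs_minus_commute add.commute)
  ultimately show ?thesis by (simp add: adjacency_isomorphism_def bij_def)
qed

lemma adjacency_isomorphism_inv:
  assumes "adjacency_isomorphism \<rho>"
  shows "adjacency_isomorphism (inv \<rho>)"
proof -
  note bij = adjacency_isomorphism_bij[OF assms] and adj = adjacency_isomorphism_adj4[OF assms]
  have "adj4 (inv \<rho> p) (inv \<rho> q) \<longleftrightarrow> adj4 p q" for p q
    using adj[of "inv \<rho> p" "inv \<rho> q"] bij by (simp add: bij_is_surj surj_f_inv_f)
  then show ?thesis using bij by (simp add: adjacency_isomorphism_def bij_imp_bij_inv)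
qed

section \<open>Background regions under isomorphisms of the grid\<close>

lemma connected4_image:
  assumes \<rho>: "adjacency_isomorphism \<rho>" and X: "connected4 X"
  shows "connected4 (\<rho> ` X)"
proof -
  note adj = adjacency_isomorphism_adj4[OF \<rho>]
  have "(\<rho> p, \<rho> q) \<in> {(a, b). a \<in> \<rho> ` X \<and> b \<in> \<rho> ` X \<and> adj4 a b}\<^sup>*"
    if "(p, q) \<in> {(a, b). a \<in> X \<and> b \<in> X \<and> adj4 a b}\<^sup>*" for p q
    using that
  proof (induction rule: rtrancl_induct)
    case base
    show ?case by simp
  next
    case (step y z)
    then have "(\<rho> y, \<rho> z) \<in> {(a, b). a \<in> \<rho> ` X \<and> b \<in> \<rho> ` X \<and> adj4 a b}" using adj by simp
    then show ?case using step(3) by (rule rtrancl_into_rtrancl[rotated])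
  qed
  then show ?thesis using X unfolding connected4_def by auto
qed

lemma bg_rotate_image:
  assumes "inj \<rho>"
  shows "bg (rotate_image \<rho> I) = \<rho> ` bg I"
  using assms by (simp add: bg_def rotate_image_def image_set_diff)

lemma outer_region_rotate_image:
  assumes \<rho>: "adjacency_isomorphism \<rho>" and R: "R \<in> outer_regions I"
  shows "\<rho> ` R \<in> outer_regions (rotate_image \<rho> I)"
proof -
  note bij = adjacency_isomorphism_bij[OF \<rho>] and adj = adjacency_isomorphism_adj4[OF \<rho>]
  have inj: "inj \<rho>" and surj: "surj \<rho>" using bij by (simp_all add: bij_def)
  have R': "R \<subseteq> bg I" "connected4 R" "\<And>X. R \<subset> X \<Longrightarrow> X \<subseteq> bg I \<Longrightarrow> \<not> connected4 X"
    "R \<inter> border I \<noteq> {}"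
    using R by (simp_all add: outer_regions_def bg_regions_def)
  have "\<not> connected4 X" if X: "\<rho> ` R \<subset> X" "X \<subseteq> \<rho> ` bg I" for X
  proof
    assume "connected4 X"
    define Y where "Y = inv \<rho> ` X"
    have XY: "X = \<rho> ` Y" unfolding Y_def using surj by (simp add: image_f_inv_f)
    have "connected4 Y"
      unfolding Y_def using connected4_image[OF adjacency_isomorphism_inv[OF \<rho>] \<open>connected4 X\<close>] .
    moreover have "R \<subset> Y" using X(1) unfolding XY using inj by (metis inj_image_subset_iff less_le_not_le)
    moreover have "Y \<subseteq> bg I" using X(2) unfolding XY using inj by (simp add: inj_image_subset_iff)
    ultimately show False using R'(3) by blast
  qed
  moreover have "\<rho> ` R \<inter> border (rotate_image \<rho> I) \<noteq> {}"
  proof -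
    obtain p q where p: "p \<in> R" "p \<in> pixels I" "adj4 p q" "q \<notin> pixels I"
      using R'(4) by (auto simp: border_def)
    have "\<rho> p \<in> \<rho> ` pixels I" "\<rho> q \<notin> \<rho> ` pixels I" "adj4 (\<rho> p) (\<rho> q)"
      using p adj inj by (simp_all add: inj_image_mem_iff)
    then have "\<rho> p \<in> border (rotate_image \<rho> I)"
      unfolding border_def rotate_image_def image.simps mem_Collect_eq by blast
    then show ?thesis using p(1) by blast
  qed
  ultimately show ?thesis
    using R'(1) connected4_image[OF \<rho> R'(2)]
    unfolding outer_regions_def bg_regions_def bg_rotate_image[OF inj] by blast
qed

text \<open>Pulling back along the inverse reduces the claim to the uniqueness of the outer region
  of \<open>I\<close>.\<close>

lemma outer_region_of_rotate_image:
  assumes \<rho>: "adjacency_isomorphism \<rho>" and unique: "\<exists>!U. U \<in> outer_regions I"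
    and U: "U \<in> outer_regions I" and U': "U' \<in> outer_regions (rotate_image \<rho> I)"
  shows "U' = \<rho> ` U"
proof -
  have bij: "bij \<rho>" using \<rho> by (simp add: adjacency_isomorphism_def)
  have "rotate_image (inv \<rho>) (rotate_image \<rho> I) = I"
    using bij by (simp add: rotate_image_def image_image bij_is_inj)
  then have "inv \<rho> ` U' \<in> outer_regions I"
    using outer_region_rotate_image[OF adjacency_isomorphism_inv[OF \<rho>] U'] by simp
  then have "inv \<rho> ` U' = U" using unique U by blast
  then show ?thesis using image_f_inv_f[OF bij_is_surj[OF bij], of U'] by simp
qed

text \<open>The equality of face boundaries yields only some edge \<open>e\<close> with image
  \<alpha>'. Its ends lie in \<open>f\<close> and \<open>R\<close>, because those of \<alpha>' lie
  in their images, and uniqueness of the loop identifies \<open>e\<close> with \<alpha>.\<close>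

lemma loop_between_rotate:
  assumes inj: "inj \<rho>" and P: "pyramid_on I P" and P': "pyramid_on (rotate_image \<rho> I) P'"
    and D: "pixels I = {a..b} \<times> {c..d}"
    and S: "spanning_tree (snd (level P (height P))) S"
    and f: "f \<in> object_faces I (generator_level P S)"
    and f': "f' \<in> object_faces (rotate_image \<rho> I) (generator_level P' S')" "f' = \<rho> ` f"
    and fb: "face_boundary (generator_level P' S') f' =
      (`) \<rho> ` face_boundary (generator_level P S) f"
    and R: "R \<inter> fg I = {}"
    and \<alpha>: "loop_between (generator_level P S) f R \<alpha>"
    and \<alpha>': "loop_between (generator_level P' S') f' (\<rho> ` R) \<alpha>'"
  shows "\<alpha>' = \<rho> ` \<alpha>"
proof -
  have fin: "finite (pixels (rotate_image \<rho> I))" by (simp add: rotate_image_def D)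
  have "\<rho> ` R \<inter> fg (rotate_image \<rho> I) = {}"
    using R inj by (simp add: rotate_image_def image_Int[symmetric])
  then obtain p' q' where pq': "\<alpha>' = {p', q'}" "p' \<in> f'" "q' \<in> \<rho> ` R"
    using loop_between_pixels[OF P' fin f'(1) \<alpha>'] by metis
  have "p' \<in> \<rho> ` f" using pq'(2) f'(2) by simp
  then obtain p where p: "p \<in> f" "p' = \<rho> p" by blast
  obtain q where q: "q \<in> R" "q' = \<rho> q" using pq'(3) by blast
  have "\<alpha>' \<in> face_boundary (generator_level P' S') f'"
    using \<alpha>' by (simp add: loop_between_def)
  then obtain e where e: "e \<in> face_boundary (generator_level P S) f" "\<alpha>' = \<rho> ` e"
    unfolding fb by blast
  have "\<rho> ` e = \<rho> ` {p, q}" using e(2) pq'(1) p(2) q(2) by simp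
  then have "e = {p, q}" unfolding inj_image_eq_iff[OF inj] .
  then show ?thesis
    using loop_between_unique[OF P D S f \<alpha> R e(1) _ p(1) q(1)] e(2) by simp
qed

section \<open>Uniqueness of the cocycle\<close>

lemma degree_image:
  assumes "inj \<rho>"
  shows "card {e \<in> (`) \<rho> ` Z. \<rho> p \<in> e} = card {e \<in> Z. p \<in> e}"
proof -
  have "{e \<in> (`) \<rho> ` Z. \<rho> p \<in> e} = (`) \<rho> ` {e \<in> Z. \<rho> p \<in> \<rho> ` e}" by blast
  then have "{e \<in> (`) \<rho> ` Z. \<rho> p \<in> e} = (`) \<rho> ` {e \<in> Z. p \<in> e}"
    unfolding inj_image_mem_iff[OF assms] .
  moreover have "inj ((`) \<rho>)" using assms by (simp add: inj_on_image)
  ultimately show ?thesis by (simp add: card_image inj_on_subset)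
qed

theorem proposition6p5:
  fixes \<rho> :: "pixel \<Rightarrow> pixel" and I :: image and P P' :: pyramid
    and S S' :: "edge set" and f f' :: "pixel set"
    and H U U' :: "pixel set" and \<alpha> \<beta> \<alpha>' \<beta>' :: edge
  assumes "grid_rotation \<rho>"
    and "object_image I"
    and "pyramid_on I P"
    and "pyramid_on (rotate_image \<rho> I) P'"
    and "spanning_tree (snd (level P (height P))) S"
    and "spanning_tree (snd (level P' (height P'))) S'"
    and "f \<in> object_faces I (generator_level P S)"
    and "f' \<in> object_faces (rotate_image \<rho> I) (generator_level P' S')"
    and "eck P' f' = (\<rho> ` fst (eck P f), (`) \<rho> ` snd (eck P f))"
    and "face_boundary (generator_level P' S') f' =
         (`) \<rho> ` face_boundary (generator_level P S) f"
    and "H \<in> holes I"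
    and "loop_between (generator_level P S) f H \<alpha>"
    and "U \<in> outer_regions I"
    and "loop_between (generator_level P S) f U \<beta>"
    and "loop_between (generator_level P' S') f' (\<rho> ` H) \<alpha>'"
    and "U' \<in> outer_regions (rotate_image \<rho> I)"
    and "loop_between (generator_level P' S') f' U' \<beta>'"
  shows "down_projected_cocycle (rotate_image \<rho> I) P' \<alpha>' \<beta>' =
         (`) \<rho> ` down_projected_cocycle I P \<alpha> \<beta>"
proof -
  note P = assms(3) and P' = assms(4) and f = assms(7) and f' = assms(8)
  have iso: "adjacency_isomorphism \<rho>"
    using assms(1) by (rule grid_rotation_adjacency_isomorphism)
  have inj: "inj \<rho>" using iso by (simp add: adjacency_isomorphism_def bij_is_inj)
  obtain a b c d where D: "pixels I = {a..b} \<times> {c..d}" and fgI: "fg I \<subseteq> pixels I"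
  proof -
    have "binary_image I" using assms(2) by (simp add: object_image_def)
    then show thesis using that unfolding binary_image_def by metis
  qed
  have fin: "finite (pixels I)" "finite (pixels (rotate_image \<rho> I))"
    by (simp_all add: D rotate_image_def)
  have "\<exists>!U. U \<in> outer_regions I" using assms(2) by (simp add: object_image_def)
  then have U': "U' = \<rho> ` U" using assms(13,16) by (rule outer_region_of_rotate_image[OF iso])
  have HU: "H \<inter> fg I = {}" "U \<inter> fg I = {}" "H \<noteq> U"
    using assms(11,13) by (auto simp: holes_def outer_regions_def bg_regions_def bg_def)
  have HU': "\<rho> ` H \<inter> fg (rotate_image \<rho> I) = {}" "\<rho> ` U \<inter> fg (rotate_image \<rho> I) = {}"
    "\<rho> ` H \<noteq> \<rho> ` U"
    using HU inj by (simp_all add: rotate_image_def image_Int[symmetric] inj_image_eq_iff)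
  \<comment> \<open>The vertex set of the equivalent contraction kernel is the receptive field
    itself, so hypothesis (a) also matches the object faces.\<close>
  have f'_eq: "f' = \<rho> ` f" using assms(9) by (simp add: eck_def)
  have eck': "snd (eck P' f') = (`) \<rho> ` snd (eck P f)" using assms(9) by simp
  note loop = loop_between_rotate[OF inj P P' D assms(5) f f' f'_eq assms(10)]
  have loops: "\<alpha>' = \<rho> ` \<alpha>" "\<beta>' = \<rho> ` \<beta>"
    using loop[OF HU(1) assms(12,15)] loop[OF HU(2) assms(14) assms(17)[unfolded U']] .
  define Z where "Z = down_projected_cocycle I P \<alpha> \<beta>"
  define Z' where "Z' = down_projected_cocycle (rotate_image \<rho> I) P' \<alpha>' \<beta>'"
  note Z = down_projected_cocycle_on_eck[OF P fin(1) f assms(12,14) HU, folded Z_def]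
  note Z' = down_projected_cocycle_on_eck[OF P' fin(2) f' assms(15) assms(17)[unfolded U'] HU',
      folded Z'_def]
  \<comment> \<open>The sum of the two cochains modulo 2. Both contain the loops, which cancel, so
    what remains lies in the contraction kernel of \<open>f'\<close>.\<close>
  define X where "X = sym_diff Z' ((`) \<rho> ` Z)"
  have XE: "X \<subseteq> snd (eck P' f')"
  proof
    fix e assume "e \<in> X"
    then consider "e \<in> Z'" "e \<notin> (`) \<rho> ` Z" | e0 where "e0 \<in> Z" "e = \<rho> ` e0" "e \<notin> Z'"
      unfolding X_def by blast
    then show "e \<in> snd (eck P' f')"
    proof cases
      case 1
      then have "e \<notin> {\<alpha>', \<beta>'}" using Z(2) unfolding loops by blast
      then show ?thesis using 1(1) Z'(3) by blast
    next
      case 2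
      then have "e0 \<notin> {\<alpha>, \<beta>}" using Z'(2) unfolding loops by blast
      then have "e0 \<in> snd (eck P f)" using 2(1) Z(3) by blast
      then show ?thesis unfolding eck' 2(2) by blast
    qed
  qed
  have f'_fg: "f' \<subseteq> fg (rotate_image \<rho> I)" using f' by (simp add: object_faces_def)
  \<comment> \<open>At foreground pixels both cocycles have even degree; other pixels meet no kernel
    edge of \<open>f'\<close>.\<close>
  have "even (card {e \<in> X. v \<in> e})" for v
  proof (cases "v \<in> fg (rotate_image \<rho> I)")
    case True
    then obtain p where p: "p \<in> fg I" "v = \<rho> p" by (auto simp: rotate_image_def)
    then have "v \<in> pixels (rotate_image \<rho> I)" "p \<in> pixels I"
      using fgI by (auto simp: rotate_image_def)
    then have "even (card {e \<in> Z'. v \<in> e})" "even (card {e \<in> (`) \<rho> ` Z. v \<in> e})"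
      using Z'(4)[OF True] Z(4)[OF p(1)] degree_image[OF inj] p(2) by simp_all
    moreover have "even (card {e \<in> X. v \<in> e}) \<longleftrightarrow>
        (even (card {e \<in> Z'. v \<in> e}) \<longleftrightarrow> even (card {e \<in> (`) \<rho> ` Z. v \<in> e}))"
      unfolding X_def
      by (rule degree_sym_diff_parity[of _ _ v "\<lambda>e. e"]) (simp_all add: Z(1) Z'(1))
    ultimately show ?thesis by simp
  next
    case False
    have "v \<notin> e" if "e \<in> X" for e
    proof -
      have "e \<subseteq> f'" using that XE by (auto simp: eck_def)
      then show ?thesis using f'_fg False by blast
    qed
    then have "{e \<in> X. v \<in> e} = {}" by blast
    then show ?thesis by (simp only: card.empty even_zero)
  qed
  moreover have "finite X" using Z(1) Z'(1) by (simp add: X_def)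
  ultimately have even: "even_edges (\<lambda>e. e) X" by (simp add: even_edges_def)
  \<comment> \<open>The union of all kernels of \<open>P'\<close> is a forest in the base grid and
    contains no nonempty cycle modulo 2.\<close>
  obtain C where "level_inv (pixels (rotate_image \<rho> I)) (level P' (height P'))
      (contracted P' (height P')) C"
    using level_inv_pyramid[OF P' fin(2) order_refl] by blast
  then have "even_free (\<lambda>e. e) (contracted P' (height P'))" by (simp add: level_inv_def)
  moreover have "X \<subseteq> contracted P' (height P')" using XE by (auto simp: eck_def contracted_def)
  ultimately have "X = {}" using even unfolding even_free_def by blast
  then have "Z' = (`) \<rho> ` Z" unfolding X_def by blast
  then show ?thesis unfolding Z_def Z'_def .
qed

end
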